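(* Let $a,b,c,d>0$ be real with $a+b\neq c+d$, let $\sigma=(a+b-c-d)^{-1}$, and let $e_1,e_2,e_3,e_4$ be the elementary symmetric polynomials in $a,b,c,d$. Write $$\tilde W_n=\tilde W_n(x^2|a,b,c,d),\quad \tilde W_n^{-+}=\tilde W_n\big(x^2\big|a-\tfrac12,b-\tfrac12,c+\tfrac12,d+\tfrac12\big),\quad \tilde W_n^{+-}=\tilde W_n\big(x^2\big|a+\tfrac12,b+\tfrac12,c-\tfrac12,d-\tfrac12\big),$$ $$\tilde W_n^{++}=\tilde W_n\big(x^2\big|a+\tfrac12,b+\tfrac12,c+\tfrac12,d+\tfrac12\big),\qquad \tilde W_n^{--}=\tilde W_n\big(x^2\big|a-\tfrac12,b-\tfrac12,c-\tfrac12,d-\tfrac12\big).$$ A representation of the rational degenerate Sklyanin algebra $\mathfrak{sK}_r$ on the Wilson polynomials is defined by the following actions: $$S_0\cdot\tilde W_n=4\sigma(n+c+d-1)\tilde W_n^{+-}+\big(4\sigma(ab-cd)-e_1\big)n(n+e_1-1)\tilde W_{n-1}^{++}-4\sigma(n+a+b-1)\tilde W_n^{-+},$$ $$S_3\cdot\tilde W_n=-4(n+a+b-1)\tilde W_n^{-+}+\tfrac12\big(8(ab+cd)-e_1^2-1\big)n(n+e_1-1)\tilde W_{n-1}^{++}-4(n+c+d-1)\tilde W_n^{+-},$$ $$S_-\cdot\tilde W_n=-\tfrac12n(n+e_1-1)\tilde W_{n-1}^{++},$$ $$\begin{aligned}S_+\cdot\tilde W_n=&\;128\,\tilde W_{n+1}^{--}+8(6\alpha-1+2\beta\sigma)(n+a+b-1)\tilde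 W_n^{-+}+8(6\alpha-1-2\beta\sigma)(n+c+d-1)\tilde W_n^{+-}\\&+8\big[(1-6\alpha)(ab+cd)-2\beta\sigma(ab-cd)+\xi\big]n(n+e_1-1)\tilde W_{n-1}^{++},\end{aligned}$$ where $$\alpha=\tfrac12e_1^2-\tfrac43e_2,\qquad\beta=-e_1^3+4e_2e_1-8e_3,\qquad\xi=\tfrac12\big(1-2e_1^2+e_1^4-256e_4\big).$$
   Context: $[A,B]=AB-BA$, $\{A,B\}=AB+BA$. $\mathfrak{sK}_r$ is the unital associative algebra generated by $S_0,S_3,S_+,S_-$ with defining relations $$[S_0,S_-]=-2\{S_-,S_-\},\qquad [S_0,S_+]=16\{S_3,S_-\}-16\{S_-,S_-\}+2\{S_+,S_-\}-4\{S_3,S_3\},$$ $$[S_+,S_-]=2\{S_0,S_3\},\qquad [S_0,S_3]=2\{S_3,S_-\}-8\{S_-,S_-\},\qquad [S_3,S_\pm]=\pm\{S_0,S_\pm\}.$$ The Wilson polynomials are $$W_n(x^2|a,b,c,d)=(a+b)_n(a+c)_n(a+d)_n\;{}_4F_3\!\left(\begin{matrix}-n,\,n+a+b+c+d-1,\,a+ix,\,a-ix\\ a+b,\,a+c,\,a+d\end{matrix}\Big|1\right),$$ with $(y)_k=y(y+1)\cdots(y+k-1)$; the right-hand side is polynomial in the parameters and is so understood for shifted parameters. The scaled polynomials are $\tilde W_n(x^2|a,b,c,d)=W_n\big(-\tfrac{x^2}{4}\big|a,b,c,d\big)$. For given parameters the $\tilde W_n$, $n\ge0$, form a basis of the polynomials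 in $x^2$, and the polynomials with shifted parameters on the right-hand sides are to be expanded in the basis with the original parameters $a,b,c,d$. Terms containing $\tilde W_{-1}^{++}$ have coefficient zero.
   Formalization: The constant ξ is taken as (1/16)(1−2e₁²+e₁⁴−256e₄) instead of (1/2)(…), because with 1/2 the relation [S₃,S₊]={S₀,S₊} fails, for example at a=b=c=1, d=2 applied to x². *)

theory Defs
  imports "HOL-Computational_Algebra.Computational_Algebra" "HOL-Library.Poly_Mapping"
begin

text \<open>
  \<open>wilson n a b c d\<close> is the polynomial \<open>W\<^sub>n\<close> in the variable \<open>y = x\<^sup>2\<close>.  The quotients
  \<open>(a + b)\<^sub>n / (a + b)\<^sub>k\<close> are written as \<open>(a + b + k)\<^sub>n\<^sub>-\<^sub>k\<close>, which makes the definition polynomial in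
  the parameters, and \<open>(a + i x)\<^sub>k (a - i x)\<^sub>k\<close> as the product of the \<open>(a + j)\<^sup>2 + x\<^sup>2\<close> for \<open>j < k\<close>.
  The lemma \<open>poly_wilson_hypergeo\<close> below recovers the hypergeometric form.
\<close>

definition wilson :: "nat \<Rightarrow> complex \<Rightarrow> complex \<Rightarrow> complex \<Rightarrow> complex \<Rightarrow> complex poly" where
  "wilson n a b c d =
     (\<Sum>k\<le>n. smult
        (pochhammer (- of_nat n) k * pochhammer (of_nat n + a + b + c + d - 1) k / fact k *
         pochhammer (a + b + of_nat k) (n - k) * pochhammer (a + c + of_nat k) (n - k) *
         pochhammer (a + d + of_nat k) (n - k))
        (\<Prod>j<k. [:(a + of_nat j)\<^sup>2, 1:]))"

lemma prod_square_eq_pochhammer: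
  fixes a x :: complex
  shows "(\<Prod>j<k. (a + of_nat j)\<^sup>2 + x\<^sup>2) = pochhammer (a + \<i> * x) k * pochhammer (a - \<i> * x) k"
  by (induction k) (auto simp: pochhammer_Suc algebra_simps power2_eq_square)

lemma poly_wilson:
  "poly (wilson n a b c d) (x\<^sup>2) =
     (\<Sum>k\<le>n. pochhammer (- of_nat n) k * pochhammer (of_nat n + a + b + c + d - 1) k *
        pochhammer (a + \<i> * x) k * pochhammer (a - \<i> * x) k / fact k *
        pochhammer (a + b + of_nat k) (n - k) * pochhammer (a + c + of_nat k) (n - k) *
        pochhammer (a + d + of_nat k) (n - k))"
  unfolding wilson_def
  by (simp add: poly_sum poly_prod prod_square_eq_pochhammer mult_ac)

lemma poly_wilson_hypergeo:
  assumes "pochhammer (a + b) n \<noteq> 0" "pochhammer (a + c) n \<noteq> 0" "pochhammer (a + d) n \<noteq> 0"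
  shows "poly (wilson n a b c d) (x\<^sup>2) =
     pochhammer (a + b) n * pochhammer (a + c) n * pochhammer (a + d) n *
     suminf (fps_nth (fps_hypergeo
        [- of_nat n, of_nat n + a + b + c + d - 1, a + \<i> * x, a - \<i> * x]
        [a + b, a + c, a + d] 1))"
proof -
  let ?F = "fps_hypergeo [- of_nat n, of_nat n + a + b + c + d - 1, a + \<i> * x, a - \<i> * x]
        [a + b, a + c, a + d] 1"
  have "suminf (fps_nth ?F) = (\<Sum>k\<le>n. fps_nth ?F k)"
    by (rule suminf_finite) (auto simp: pochhammer_of_nat_eq_0_iff)
  moreover have "pochhammer u n = pochhammer u k * pochhammer (u + of_nat k) (n - k)"
    if "k \<le> n" for u :: complex and k
    using pochhammer_product[OF that] .
  moreover have "pochhammer u k \<noteq> 0" if "pochhammer u n \<noteq> 0" "k \<le> n" for u :: complex and k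
    using pochhammer_neq_0_mono that by blast
  ultimately show ?thesis
    using assms unfolding poly_wilson
    by (simp add: sum_distrib_left) (intro sum.cong refl, simp add: field_simps)
qed

text \<open>\<open>W\<^sub>n(- x\<^sup>2 / 4 | a, b, c, d)\<close>, again as a polynomial in \<open>y = x\<^sup>2\<close>.\<close>

definition wilson_scaled :: "complex \<Rightarrow> complex \<Rightarrow> complex \<Rightarrow> complex \<Rightarrow> nat \<Rightarrow> complex poly" where
  "wilson_scaled a b c d n = pcompose (wilson n a b c d) [:0, - 1 / 4:]"

datatype sk_gen = G0 | G3 | GPlus | GMinus

datatype sk_word = Word "sk_gen list"

instantiation sk_word :: monoid_add
begin

definition zero_sk_word :: sk_word where "0 = Word []"

fun plus_sk_word :: "sk_word \<Rightarrow> sk_word \<Rightarrow> sk_word" where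
  "Word u + Word v = Word (u @ v)"

instance
proof
  fix u v w :: sk_word
  show "u + v + w = u + (v + w)" by (cases u; cases v; cases w) simp
  show "0 + u = u" by (cases u) (simp add: zero_sk_word_def)
  show "u + 0 = u" by (cases u) (simp add: zero_sk_word_def)
qed

end

text \<open>
  Words are written additively, so that finitely supported functions on words, with the
  convolution product of \<^theory>\<open>HOL-Library.Poly_Mapping\<close>, are the noncommutative polynomials.
\<close>

type_synonym sk_free = "sk_word \<Rightarrow>\<^sub>0 complex"

definition gen :: "sk_gen \<Rightarrow> sk_free" where
  "gen g = Poly_Mapping.single (Word [g]) 1"

definition const :: "complex \<Rightarrow> sk_free" where
  "const c = Poly_Mapping.single 0 c"

lemma const_0 [simp]: "const 0 = 0"
  and const_1 [simp]: "const 1 = 1"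
  and const_add: "const (c + d) = const c + const d"
  and const_mult: "const (c * d) = const c * const d"
  by (simp_all add: const_def single_add mult_single)

lemma poly_mapping_single_induct [case_names single sum]:
  fixes f :: "'a \<Rightarrow>\<^sub>0 'b::monoid_add"
  assumes single: "\<And>k v. P (Poly_Mapping.single k v)"
    and sum: "\<And>f g. P f \<Longrightarrow> P g \<Longrightarrow> P (f + g)"
  shows "P f"
proof (induction f rule: update_induct)
  case const
  show ?case using single[of undefined 0] by simp
next
  case (update f a b)
  have "Poly_Mapping.update a b f = Poly_Mapping.single a b + f"
    using update.hyps
    by (intro poly_mapping_eqI)
       (auto simp: lookup_update lookup_add lookup_single when_def in_keys_iff)
  then show ?case using single sum update.IH by simp
qed

lemma const_commute: "const c * u = u * const c"
proof (induction u rule: poly_mapping_single_induct)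
  case (single k v)
  show ?case by (simp add: const_def mult_single mult.commute)
next
  case (sum f g)
  then show ?case by (simp add: algebra_simps)
qed

definition commutator :: "'a::ring \<Rightarrow> 'a \<Rightarrow> 'a" where
  "commutator A B = A * B - B * A"

definition anticommutator :: "'a::ring \<Rightarrow> 'a \<Rightarrow> 'a" where
  "anticommutator A B = A * B + B * A"

definition sk_relations :: "'a::ring_1 \<Rightarrow> 'a \<Rightarrow> 'a \<Rightarrow> 'a \<Rightarrow> ('a \<times> 'a) set" where
  "sk_relations S0 S3 SP SM =
    {(commutator S0 SM, - 2 * anticommutator SM SM),
     (commutator S0 SP, 16 * anticommutator S3 SM - 16 * anticommutator SM SM
        + 2 * anticommutator SP SM - 4 * anticommutator S3 S3),
     (commutator SP SM, 2 * anticommutator S0 S3),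
     (commutator S0 S3, 2 * anticommutator S3 SM - 8 * anticommutator SM SM),
     (commutator S3 SP, anticommutator S0 SP),
     (commutator S3 SM, - anticommutator S0 SM)}"

inductive_set two_sided_ideal :: "'a::ring_1 set \<Rightarrow> 'a set" for R where
  base: "r \<in> R \<Longrightarrow> r \<in> two_sided_ideal R"
| zero: "0 \<in> two_sided_ideal R"
| add: "u \<in> two_sided_ideal R \<Longrightarrow> v \<in> two_sided_ideal R \<Longrightarrow> u + v \<in> two_sided_ideal R"
| mult_left: "u \<in> two_sided_ideal R \<Longrightarrow> w * u \<in> two_sided_ideal R"
| mult_right: "u \<in> two_sided_ideal R \<Longrightarrow> u * w \<in> two_sided_ideal R"

lemma two_sided_ideal_uminus: "u \<in> two_sided_ideal R \<Longrightarrow> - u \<in> two_sided_ideal R"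
  using two_sided_ideal.mult_left[of u R "- 1"] by simp

definition sk_ideal :: "sk_free set" where
  "sk_ideal = two_sided_ideal
     ((\<lambda>(l, r). l - r) ` sk_relations (gen G0) (gen G3) (gen GPlus) (gen GMinus))"

lemma sk_ideal_zero: "0 \<in> sk_ideal"
  and sk_ideal_add: "u \<in> sk_ideal \<Longrightarrow> v \<in> sk_ideal \<Longrightarrow> u + v \<in> sk_ideal"
  and sk_ideal_mult_left: "u \<in> sk_ideal \<Longrightarrow> w * u \<in> sk_ideal"
  and sk_ideal_mult_right: "u \<in> sk_ideal \<Longrightarrow> u * w \<in> sk_ideal"
  and sk_ideal_uminus: "u \<in> sk_ideal \<Longrightarrow> - u \<in> sk_ideal"
  by (auto simp: sk_ideal_def intro: two_sided_ideal.intros two_sided_ideal_uminus)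

definition sk_cong :: "sk_free \<Rightarrow> sk_free \<Rightarrow> bool" where
  "sk_cong u v \<longleftrightarrow> u - v \<in> sk_ideal"

lemma equivp_sk_cong: "equivp sk_cong"
proof (rule equivpI)
  show "reflp sk_cong" by (auto simp: reflp_def sk_cong_def sk_ideal_zero)
  show "symp sk_cong"
    unfolding symp_def sk_cong_def using sk_ideal_uminus by fastforce
  show "transp sk_cong"
    unfolding transp_def sk_cong_def using sk_ideal_add by fastforce
qed

quotient_type sklyanin = sk_free / sk_cong
  by (rule equivp_sk_cong)

lemma lookup_mult_0:
  fixes u v :: sk_free
  shows "Poly_Mapping.lookup (u * v) 0 = Poly_Mapping.lookup u 0 * Poly_Mapping.lookup v 0"
proof (induction u rule: poly_mapping_single_induct)
  case (single k c)
  show ?case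
  proof (induction v rule: poly_mapping_single_induct)
    case (single l e)
    show ?case
      by (cases k; cases l) (auto simp: mult_single lookup_single when_def zero_sk_word_def)
  next
    case (sum f g)
    then show ?case by (simp add: algebra_simps lookup_add)
  qed
next
  case (sum f g)
  then show ?case by (simp add: algebra_simps lookup_add)
qed

lemma sk_ideal_lookup_0:
  assumes "u \<in> sk_ideal"
  shows "Poly_Mapping.lookup u 0 = 0"
proof -
  have gen: "Poly_Mapping.lookup (gen g) 0 = 0" for g
    by (simp add: gen_def lookup_single when_def zero_sk_word_def)
  show ?thesis
    using assms unfolding sk_ideal_def
    by (induction rule: two_sided_ideal.induct)
       (auto simp: sk_relations_def commutator_def anticommutator_def lookup_add lookup_minus
          lookup_mult_0 gen)
qed

instantiation sklyanin :: ring_1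
begin

lift_definition zero_sklyanin :: sklyanin is 0 .

lift_definition one_sklyanin :: sklyanin is 1 .

lift_definition plus_sklyanin :: "sklyanin \<Rightarrow> sklyanin \<Rightarrow> sklyanin" is "(+)"
  unfolding sk_cong_def using sk_ideal_add by (fastforce simp: algebra_simps)

lift_definition uminus_sklyanin :: "sklyanin \<Rightarrow> sklyanin" is uminus
  unfolding sk_cong_def using sk_ideal_uminus by fastforce

lift_definition minus_sklyanin :: "sklyanin \<Rightarrow> sklyanin \<Rightarrow> sklyanin" is "(-)"
proof -
  fix u u' v v' assume *: "sk_cong u u'" "sk_cong v v'"
  have "u - v - (u' - v') = (u - u') + - (v - v')" by simp
  also have "\<dots> \<in> sk_ideal"
    using * sk_ideal_add sk_ideal_uminus unfolding sk_cong_def by blast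
  finally show "sk_cong (u - v) (u' - v')" by (simp add: sk_cong_def)
qed

lift_definition times_sklyanin :: "sklyanin \<Rightarrow> sklyanin \<Rightarrow> sklyanin" is "(*)"
proof -
  fix u u' v v' assume *: "sk_cong u u'" "sk_cong v v'"
  have "u * v - u' * v' = (u - u') * v + u' * (v - v')" by (simp add: algebra_simps)
  also have "\<dots> \<in> sk_ideal"
    using * sk_ideal_add sk_ideal_mult_left sk_ideal_mult_right unfolding sk_cong_def by blast
  finally show "sk_cong (u * v) (u' * v')" by (simp add: sk_cong_def)
qed

instance
proof
  fix u v w :: sklyanin
  show "u + v + w = u + (v + w)" by transfer (simp add: sk_cong_def sk_ideal_zero add.assoc)
  show "u + v = v + u" by transfer (simp add: sk_cong_def sk_ideal_zero add.commute)
  show "0 + u = u" by transfer (simp add: sk_cong_def sk_ideal_zero)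
  show "- u + u = 0" by transfer (simp add: sk_cong_def sk_ideal_zero)
  show "u - v = u + - v" by transfer (simp add: sk_cong_def sk_ideal_zero)
  show "u * v * w = u * (v * w)" by transfer (simp add: sk_cong_def sk_ideal_zero mult.assoc)
  show "1 * u = u" by transfer (simp add: sk_cong_def sk_ideal_zero)
  show "u * 1 = u" by transfer (simp add: sk_cong_def sk_ideal_zero)
  show "(u + v) * w = u * w + v * w"
    by transfer (simp add: sk_cong_def sk_ideal_zero distrib_right)
  show "u * (v + w) = u * v + u * w"
    by transfer (simp add: sk_cong_def sk_ideal_zero distrib_left)
  show "(0::sklyanin) \<noteq> 1"
    by transfer (auto simp: sk_cong_def lookup_minus dest: sk_ideal_lookup_0)
qed

end

lift_definition sk_scale :: "complex \<Rightarrow> sklyanin \<Rightarrow> sklyanin" is "\<lambda>c u. const c * u"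
  unfolding sk_cong_def using sk_ideal_mult_left by (metis right_diff_distrib)

interpretation sklyanin: vector_space sk_scale
proof
  fix c d :: complex and u v :: sklyanin
  show "sk_scale c (u + v) = sk_scale c u + sk_scale c v"
    by transfer (simp add: sk_cong_def sk_ideal_zero distrib_left)
  show "sk_scale (c + d) u = sk_scale c u + sk_scale d u"
    by transfer (simp add: sk_cong_def sk_ideal_zero distrib_right const_add)
  show "sk_scale c (sk_scale d u) = sk_scale (c * d) u"
    by transfer (simp add: sk_cong_def sk_ideal_zero const_mult mult.assoc)
  show "sk_scale 1 u = u"
    by transfer (simp add: sk_cong_def sk_ideal_zero)
qed

lemma sk_scale_mult_left: "sk_scale c u * v = sk_scale c (u * v)"
  by transfer (simp add: sk_cong_def sk_ideal_zero mult.assoc)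

lemma sk_scale_mult_right: "u * sk_scale c v = sk_scale c (u * v)"
  by transfer (metis const_commute equivp_reflp equivp_sk_cong mult.assoc)

lift_definition S0 :: sklyanin is "gen G0" .
lift_definition S3 :: sklyanin is "gen G3" .
lift_definition S_plus :: sklyanin is "gen GPlus" .
lift_definition S_minus :: sklyanin is "gen GMinus" .

lemma sklyanin_relations:
  assumes "(l, r) \<in> sk_relations S0 S3 S_plus S_minus"
  shows "l = r"
proof -
  have numeral_abs: "numeral k = abs_sklyanin (numeral k)" for k
  proof (induction k)
    case One
    show ?case by (simp add: one_sklyanin_def)
  next
    case (Bit0 k)
    then show ?case by (simp only: numeral.simps plus_sklyanin.abs_eq)
  next
    case (Bit1 k)
    then show ?case
      by (simp only: numeral.simps plus_sklyanin.abs_eq one_sklyanin_def)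
  qed
  note [simp] = S0_def S3_def S_plus_def S_minus_def commutator_def anticommutator_def
  have "\<exists>p\<in>sk_relations (gen G0) (gen G3) (gen GPlus) (gen GMinus).
          l = abs_sklyanin (fst p) \<and> r = abs_sklyanin (snd p)"
    using assms unfolding sk_relations_def numeral_abs
    by (auto simp: plus_sklyanin.abs_eq minus_sklyanin.abs_eq times_sklyanin.abs_eq
        uminus_sklyanin.abs_eq)
  then obtain p where p: "p \<in> sk_relations (gen G0) (gen G3) (gen GPlus) (gen GMinus)"
    and "l = abs_sklyanin (fst p)" "r = abs_sklyanin (snd p)" by blast
  moreover have "sk_cong (fst p) (snd p)"
    using p unfolding sk_cong_def sk_ideal_def
    by (intro two_sided_ideal.base) (force simp: case_prod_beta)
  ultimately show ?thesis by (simp add: sklyanin.abs_eq_iff)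
qed

text \<open>A unital algebra homomorphism from \<open>sklyanin\<close> to the endomorphisms of a complex vector space.\<close>

definition sk_representation ::
    "(complex \<Rightarrow> 'v::ab_group_add \<Rightarrow> 'v) \<Rightarrow> (sklyanin \<Rightarrow> 'v \<Rightarrow> 'v) \<Rightarrow> bool" where
  "sk_representation scale \<rho> \<longleftrightarrow>
     (\<forall>u. Vector_Spaces.linear scale scale (\<rho> u)) \<and>
     (\<forall>v. Vector_Spaces.linear sk_scale scale (\<lambda>u. \<rho> u v)) \<and>
     \<rho> 1 = id \<and>
     (\<forall>u w. \<rho> (u * w) = \<rho> u \<circ> \<rho> w)"

end

theory Submission
  imports Defs
begin

text \<open>
  For a polynomial \<open>P\<close> let \<open>L\<^sub>P\<close> be the operator on polynomials in \<open>x\<^sup>2\<close> with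
  \<open>x (L\<^sub>P f)(x\<^sup>2) = P(x) f((x + 1)\<^sup>2) - P(- x) f((x - 1)\<^sup>2)\<close>; it is linear in \<open>P\<close>.  With
  \<open>s = 2 x + e\<^sub>1 - 2\<close>, the operators of the symbols \<open>- s\<close>, \<open>- (s\<^sup>2 + 1) / 2\<close>, \<open>(s\<^sup>2 - 1)\<^sup>2 / 2\<close>, \<open>- 1 / 2\<close>
  satisfy the relations of \<open>S\<^sub>0, S\<^sub>3, S\<^sub>+, S\<^sub>-\<close>, which is a comparison of the coefficients of
  \<open>f((x + 2)\<^sup>2)\<close>, \<open>f(x\<^sup>2)\<close> and \<open>f((x - 2)\<^sup>2)\<close>.
  On the other hand \<open>L\<^sub>P\<close> shifts the parameters of the Wilson polynomials by \<open>1 / 2\<close> when \<open>P\<close> is the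
  product of the factors \<open>u - 1 / 2 + x / 2\<close> over \<open>u\<close> in \<open>{}\<close>, \<open>{a, b}\<close>, \<open>{c, d}\<close> or \<open>{a, b, c, d}\<close>.
  The stated actions are the expansions of the four symbols in these four products.
  All products are evaluated on the basis \<open>(a + x / 2)\<^sub>k (a - x / 2)\<^sub>k\<close>, so that the symmetry of the
  Wilson polynomials in their parameters is not needed.
\<close>

section \<open>Representations of the quotient algebra\<close>

fun word_action :: "(sk_gen \<Rightarrow> 'v \<Rightarrow> 'v) \<Rightarrow> sk_word \<Rightarrow> 'v \<Rightarrow> 'v" where
  "word_action T (Word gs) = foldr T gs"

lemma word_action_zero: "word_action T 0 = id"
  by (simp add: zero_sk_word_def)

lemma word_action_add: "word_action T (u + v) = word_action T u \<circ> word_action T v"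
  by (cases u; cases v) (simp add: fun_eq_iff)

lemma numeral_sk_free_eq_const: "(numeral k :: sk_free) = const (numeral k)"
proof (induction k)
  case One
  show ?case by simp
next
  case (Bit0 k)
  then show ?case by (simp only: numeral.simps const_add)
next
  case (Bit1 k)
  then show ?case by (simp only: numeral.simps const_add const_1)
qed

text \<open>The six defining relations applied to a vector, with {A, A} written as 2 A^2; this
  doubles the coefficients of the squares to 4, 32, 8 and 16.\<close>

locale sk_generator_action = vector_space scale
  for scale :: "complex \<Rightarrow> 'v::ab_group_add \<Rightarrow> 'v" +
  fixes T :: "sk_gen \<Rightarrow> 'v \<Rightarrow> 'v"
  assumes linear_gen: "Vector_Spaces.linear scale scale (T g)"
    and rel_0_minus:
      "T G0 (T GMinus v) - T GMinus (T G0 v) = - scale 4 (T GMinus (T GMinus v))"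
    and rel_0_plus:
      "T G0 (T GPlus v) - T GPlus (T G0 v) =
        scale 16 (T G3 (T GMinus v) + T GMinus (T G3 v)) - scale 32 (T GMinus (T GMinus v))
        + scale 2 (T GPlus (T GMinus v) + T GMinus (T GPlus v)) - scale 8 (T G3 (T G3 v))"
    and rel_plus_minus:
      "T GPlus (T GMinus v) - T GMinus (T GPlus v) = scale 2 (T G0 (T G3 v) + T G3 (T G0 v))"
    and rel_0_3:
      "T G0 (T G3 v) - T G3 (T G0 v) =
        scale 2 (T G3 (T GMinus v) + T GMinus (T G3 v)) - scale 16 (T GMinus (T GMinus v))"
    and rel_3_plus:
      "T G3 (T GPlus v) - T GPlus (T G3 v) = T G0 (T GPlus v) + T GPlus (T G0 v)"
    and rel_3_minus:
      "T G3 (T GMinus v) - T GMinus (T G3 v) = - (T G0 (T GMinus v) + T GMinus (T G0 v))"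
begin

definition free_action :: "sk_free \<Rightarrow> 'v \<Rightarrow> 'v" where
  "free_action u v = Sum_any (\<lambda>w. scale (Poly_Mapping.lookup u w) (word_action T w v))"

lemma free_action_single:
  "free_action (Poly_Mapping.single w c) v = scale c (word_action T w v)"
proof -
  have "scale (c when w = w') x = (scale c x when w = w')" for w' x
    by (simp add: when_def)
  then show ?thesis
    by (simp add: free_action_def lookup_single)
qed

lemma free_action_add: "free_action (u + u') v = free_action u v + free_action u' v"
proof -
  \<comment> \<open>\<open>Sum_any\<close> is additive on finitely supported summands; here the
    support lies within that of the coefficients.\<close>
  have "finite {w. scale (Poly_Mapping.lookup q w) (word_action T w v) \<noteq> 0}" for q
    by (rule finite_subset[OF _ finite_lookup[of q]]) auto
  then show ?thesis
    by (simp add: free_action_def lookup_add scale_left_distrib Sum_any.distrib)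
qed

lemma free_action_zero: "free_action 0 v = 0"
  by (simp add: free_action_def)

lemma free_action_uminus: "free_action (- u) v = - free_action u v"
  using free_action_add[of u "- u" v] by (simp add: free_action_zero eq_neg_iff_add_eq_0 add.commute)

lemma free_action_diff: "free_action (u - u') v = free_action u v - free_action u' v"
  using free_action_add[of u "- u'" v] by (simp add: free_action_uminus)

lemma linear_word_action: "Vector_Spaces.linear scale scale (word_action T w)"
proof (cases w)
  case (Word gs)
  have "Vector_Spaces.linear scale scale (foldr T gs)"
  proof (induction gs)
    case Nil
    show ?case using linear_id by (simp add: id_def)
  next
    case (Cons g gs)
    show ?case using Vector_Spaces.linear_compose[OF Cons linear_gen[of g]] by (simp add: o_def)
  qed
  then show ?thesis by (simp add: Word)
qed

lemma free_action_add_right: "free_action u (v + v') = free_action u v + free_action u v'"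
proof (induction u rule: poly_mapping_single_induct)
  case (single k c)
  then show ?case
    using linear_word_action[of k]
    by (simp add: free_action_single Vector_Spaces.linear_iff scale_right_distrib)
next
  case (sum f g)
  then show ?case by (simp add: free_action_add algebra_simps)
qed

lemma free_action_scale_right: "free_action u (scale r v) = scale r (free_action u v)"
proof (induction u rule: poly_mapping_single_induct)
  case (single k c)
  then show ?case
    using linear_word_action[of k]
    by (simp add: free_action_single Vector_Spaces.linear_iff scale_right_distrib mult.commute)
next
  case (sum f g)
  then show ?case by (simp add: free_action_add algebra_simps)
qed

lemma free_action_zero_right: "free_action u 0 = 0"
  using free_action_scale_right[of u 0 0] by simp

text \<open>Both sides are additive in \<open>u\<close> and in \<open>u'\<close>, so single words
  suffice, and there concatenation acts as composition.\<close>

lemma free_action_mult: "free_action (u * u') v = free_action u (free_action u' v)"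
proof (induction u rule: poly_mapping_single_induct)
  case (single k c)
  show ?case
  proof (induction u' rule: poly_mapping_single_induct)
    case (single l e)
    have "word_action T k (scale e (word_action T l v)) = scale e (word_action T k (word_action T l v))"
      using linear_word_action[of k] by (simp add: Vector_Spaces.linear_iff)
    then show ?case
      by (simp add: mult_single free_action_single word_action_add)
  next
    case (sum f g)
    then show ?case by (simp add: free_action_add free_action_add_right distrib_left)
  qed
next
  case (sum f g)
  then show ?case by (simp add: free_action_add distrib_right)
qed

lemma free_action_const: "free_action (const c) v = scale c v"
  by (simp add: const_def free_action_single word_action_zero)

lemma free_action_gen: "free_action (gen g) v = T g v"
  by (simp add: gen_def free_action_single)

text \<open>The elements acting as zero are closed under the ideal operations, and each generator of
  the ideal is among them by one of the six assumed relations.\<close>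

lemma free_action_sk_ideal:
  assumes "u \<in> sk_ideal"
  shows "free_action u v = 0"
proof -
  note hom = free_action_add free_action_diff free_action_uminus free_action_mult
    free_action_const free_action_gen
  show ?thesis
    using assms unfolding sk_ideal_def
  \<comment> \<open>For right multiples the hypothesis is applied at the vector
    \<open>free_action w v\<close>, so \<open>v\<close> has to vary.\<close>
  proof (induction arbitrary: v rule: two_sided_ideal.induct)
    case (base r)
    then consider
        "r = commutator (gen G0) (gen GMinus) - (- 2 * anticommutator (gen GMinus) (gen GMinus))"
      | "r = commutator (gen G0) (gen GPlus) - (16 * anticommutator (gen G3) (gen GMinus)
          - 16 * anticommutator (gen GMinus) (gen GMinus)
          + 2 * anticommutator (gen GPlus) (gen GMinus) - 4 * anticommutator (gen G3) (gen G3))"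
      | "r = commutator (gen GPlus) (gen GMinus) - 2 * anticommutator (gen G0) (gen G3)"
      | "r = commutator (gen G0) (gen G3) - (2 * anticommutator (gen G3) (gen GMinus)
          - 8 * anticommutator (gen GMinus) (gen GMinus))"
      | "r = commutator (gen G3) (gen GPlus) - anticommutator (gen G0) (gen GPlus)"
      | "r = commutator (gen G3) (gen GMinus) - (- anticommutator (gen G0) (gen GMinus))"
      unfolding sk_relations_def by auto
    then show ?case
    proof cases
      case 1
      show ?thesis
        using rel_0_minus[of v] scale_left_distrib[of 2 2 "T GMinus (T GMinus v)"]
        by (simp add: 1 commutator_def anticommutator_def numeral_sk_free_eq_const hom
            scale_right_distrib)
    next
      case 2
      show ?thesis
        using rel_0_plus[of v] scale_left_distrib[of 16 16 "T GMinus (T GMinus v)"]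
          scale_left_distrib[of 4 4 "T G3 (T G3 v)"]
        by (simp add: 2 commutator_def anticommutator_def numeral_sk_free_eq_const hom
            scale_right_distrib)
    next
      case 3
      show ?thesis
        using rel_plus_minus[of v]
        by (simp add: 3 commutator_def anticommutator_def numeral_sk_free_eq_const hom)
    next
      case 4
      show ?thesis
        using rel_0_3[of v] scale_left_distrib[of 8 8 "T GMinus (T GMinus v)"]
        by (simp add: 4 commutator_def anticommutator_def numeral_sk_free_eq_const hom
            scale_right_distrib)
    next
      case 5
      show ?thesis
        using rel_3_plus[of v] by (simp add: 5 commutator_def anticommutator_def hom)
    next
      case 6
      show ?thesis
        using rel_3_minus[of v]
        by (simp add: 6 commutator_def anticommutator_def hom add_eq_0_iff)
    qed
  qed (simp_all add: free_action_zero free_action_add free_action_mult free_action_zero_right)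
qed

section \<open>Descent to the quotient algebra\<close>

definition action :: "sklyanin \<Rightarrow> 'v \<Rightarrow> 'v" where
  "action u = free_action (rep_sklyanin u)"

text \<open>Representatives of one class differ by an element of the ideal, which acts as zero, so
  the choice made by \<open>rep_sklyanin\<close> is immaterial.\<close>

lemma action_abs: "action (abs_sklyanin u) = free_action u"
proof
  fix v
  have "sk_cong (rep_sklyanin (abs_sklyanin u)) u"
    using Quotient3_rep_abs[OF Quotient3_sklyanin] equivp_sk_cong by (metis equivp_reflp)
  then show "action (abs_sklyanin u) v = free_action u v"
    using free_action_sk_ideal by (force simp: action_def sk_cong_def free_action_diff)
qed

lemma sk_representation_action: "sk_representation scale action"
proof -
  have add: "action (u + u') v = action u v + action u' v" for u u' v
    by (induct u rule: sklyanin.abs_induct, induct u' rule: sklyanin.abs_induct)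
       (simp add: plus_sklyanin.abs_eq action_abs free_action_add)
  have scale: "action (sk_scale c u) v = scale c (action u v)" for c u v
    by (induct u rule: sklyanin.abs_induct)
       (simp add: sk_scale.abs_eq action_abs free_action_mult free_action_const)
  have one: "action 1 = id"
    using free_action_const[of 1] by (auto simp: one_sklyanin_def action_abs)
  have mult: "action (u * u') = action u \<circ> action u'" for u u'
    by (induct u rule: sklyanin.abs_induct, induct u' rule: sklyanin.abs_induct)
       (auto simp: times_sklyanin.abs_eq action_abs free_action_mult)
  show ?thesis
    unfolding sk_representation_def
    by (simp add: Vector_Spaces.linear_iff vector_space_axioms sklyanin.vector_space_axioms
        add scale one mult)
       (simp add: action_def free_action_add_right free_action_scale_right)
qed

lemma action_gen:
  "action S0 = T G0" "action S3 = T G3" "action S_plus = T GPlus" "action S_minus = T GMinus"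
  by (auto simp: S0_def S3_def S_plus_def S_minus_def action_abs free_action_gen)

end

text \<open>The quotient is spanned by the classes of words, and these are products of
  generators.\<close>

lemma sk_representation_eqI:
  assumes \<rho>: "sk_representation scale \<rho>" and \<rho>': "sk_representation scale \<rho>'"
    and eq: "\<rho> S0 = \<rho>' S0" "\<rho> S3 = \<rho>' S3" "\<rho> S_plus = \<rho>' S_plus" "\<rho> S_minus = \<rho>' S_minus"
  shows "\<rho> = \<rho>'"
proof -
  have add: "\<rho> (u + v) x = \<rho> u x + \<rho> v x" "\<rho>' (u + v) x = \<rho>' u x + \<rho>' v x"
    and scale: "\<rho> (sk_scale r u) x = scale r (\<rho> u x)" "\<rho>' (sk_scale r u) x = scale r (\<rho>' u x)"
    and mult: "\<rho> (u * v) = \<rho> u \<circ> \<rho> v" "\<rho>' (u * v) = \<rho>' u \<circ> \<rho>' v"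
    and one: "\<rho> 1 = id" "\<rho>' 1 = id"
    for u v x r
    using \<rho> \<rho>' by (auto simp: sk_representation_def Vector_Spaces.linear_iff)
  have gens: "\<rho> (abs_sklyanin (gen g)) = \<rho>' (abs_sklyanin (gen g))" for g
    using eq by (cases g) (simp_all add: S0_def S3_def S_plus_def S_minus_def)
  have words: "\<rho> (abs_sklyanin (Poly_Mapping.single (Word gs) 1)) =
      \<rho>' (abs_sklyanin (Poly_Mapping.single (Word gs) 1))" for gs
  proof (induction gs)
    case Nil
    show ?case
      using one by (simp add: one_sklyanin_def flip: zero_sk_word_def)
  next
    case (Cons g gs)
    have "abs_sklyanin (Poly_Mapping.single (Word (g # gs)) 1) =
        abs_sklyanin (gen g) * abs_sklyanin (Poly_Mapping.single (Word gs) 1)"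
      by (simp add: times_sklyanin.abs_eq gen_def mult_single)
    then show ?case by (simp add: mult Cons gens)
  qed
  have "\<rho> (abs_sklyanin u) x = \<rho>' (abs_sklyanin u) x" for u x
  proof (induction u rule: poly_mapping_single_induct)
    case (single k c)
    have "abs_sklyanin (Poly_Mapping.single k c) =
        sk_scale c (abs_sklyanin (Poly_Mapping.single k 1))"
      by (simp add: sk_scale.abs_eq const_def mult_single)
    then show ?case by (cases k) (simp add: scale words)
  next
    case (sum f g)
    then show ?case by (simp add: add flip: plus_sklyanin.abs_eq)
  qed
  then have "\<rho> u = \<rho>' u" for u
    by (induct u rule: sklyanin.abs_induct) blast
  then show ?thesis by blast
qed

section \<open>Difference operators\<close>

text \<open>Every complex number has a square root, so the two polynomials agree off finitely many
  values. This allows operator identities to be checked away from the zeros of denominators.\<close>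

lemma poly_square_eqI:
  fixes p q :: "complex poly"
  assumes "finite S" and "\<And>x. x \<notin> S \<Longrightarrow> poly p (x\<^sup>2) = poly q (x\<^sup>2)"
  shows "p = q"
proof (rule ccontr)
  assume "p \<noteq> q"
  then have "finite {y. poly (p - q) y = 0}"
    by (intro poly_roots_finite) simp
  moreover have "UNIV - (\<lambda>x. x\<^sup>2) ` S \<subseteq> {y. poly (p - q) y = 0}"
  proof
    fix y :: complex assume y: "y \<in> UNIV - (\<lambda>x. x\<^sup>2) ` S"
    have "csqrt y \<notin> S" using y by (metis DiffD2 image_eqI power2_csqrt)
    then show "y \<in> {y. poly (p - q) y = 0}"
      using assms(2)[of "csqrt y"] by simp
  qed
  ultimately have "finite (UNIV - (\<lambda>x. x\<^sup>2) ` S)"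
    using finite_subset by blast
  then show False
    using assms(1) infinite_UNIV_char_0[where 'a = complex] by simp
qed

text \<open>Horner's step exchanges the parts: if p = g + x h with g and h taken at x^2, then c + x
  p has even part c + x^2 h and odd part x g.\<close>

lemma poly_even_odd_decomposition:
  fixes p :: "'a::comm_ring_1 poly"
  shows "\<exists>g h. \<forall>x. poly p x = poly g (x\<^sup>2) + x * poly h (x\<^sup>2)"
proof (induction p)
  case 0
  show ?case by (intro exI[of _ 0]) simp
next
  case (pCons c p)
  then obtain g h where "\<And>x. poly p x = poly g (x\<^sup>2) + x * poly h (x\<^sup>2)" by blast
  then have "poly (pCons c p) x = poly (pCons c h) (x\<^sup>2) + x * poly g (x\<^sup>2)" for x
    by (simp add: algebra_simps power2_eq_square)
  then show ?case by blast
qed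

text \<open>The right-hand side is an odd polynomial in x, hence x times a unique polynomial in x^2;
  the description selects this quotient.\<close>

definition shift_op :: "complex poly \<Rightarrow> complex poly \<Rightarrow> complex poly" where
  "shift_op P f = (THE g. \<forall>x. x * poly g (x\<^sup>2) =
     poly P x * poly f ((x + 1)\<^sup>2) - poly P (- x) * poly f ((x - 1)\<^sup>2))"

lemma shift_op_eqI:
  assumes "\<And>x. x \<noteq> 0 \<Longrightarrow> x * poly g (x\<^sup>2) =
     poly P x * poly f ((x + 1)\<^sup>2) - poly P (- x) * poly f ((x - 1)\<^sup>2)"
  shows "shift_op P f = g"
  unfolding shift_op_def
proof (rule the_equality)
  show "\<forall>x. x * poly g (x\<^sup>2) =
      poly P x * poly f ((x + 1)\<^sup>2) - poly P (- x) * poly f ((x - 1)\<^sup>2)"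
  proof
    fix x :: complex
    show "x * poly g (x\<^sup>2) =
      poly P x * poly f ((x + 1)\<^sup>2) - poly P (- x) * poly f ((x - 1)\<^sup>2)"
      \<comment> \<open>At x = 0 both shifted arguments equal 1 and the two terms cancel.\<close>
      using assms[of x] by (cases "x = 0") simp_all
  qed
next
  fix g' assume *: "\<forall>x. x * poly g' (x\<^sup>2) =
      poly P x * poly f ((x + 1)\<^sup>2) - poly P (- x) * poly f ((x - 1)\<^sup>2)"
  show "g' = g"
  proof (rule poly_square_eqI[of "{0}"])
    fix x :: complex assume "x \<notin> {0}"
    then show "poly g' (x\<^sup>2) = poly g (x\<^sup>2)"
      using assms[of x] * by (metis mult_left_cancel singletonI)
  qed simp
qed

text \<open>With p(x) = P(x) f((x + 1)^2) the right-hand side is p(x) - p(-x), twice the odd part of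
  p; this settles the existence that the definition presupposes.\<close>

lemma poly_shift_op:
  "x * poly (shift_op P f) (x\<^sup>2) =
     poly P x * poly f ((x + 1)\<^sup>2) - poly P (- x) * poly f ((x - 1)\<^sup>2)"
proof -
  define p where "p = P * pcompose f ([:1, 1:]\<^sup>2)"
  have p: "poly p x = poly P x * poly f ((x + 1)\<^sup>2)" for x
    by (simp add: p_def poly_pcompose add.commute)
  obtain g h where gh: "\<And>x. poly p x = poly g (x\<^sup>2) + x * poly h (x\<^sup>2)"
    using poly_even_odd_decomposition[of p] by blast
  have *: "x * poly (smult 2 h) (x\<^sup>2) =
     poly P x * poly f ((x + 1)\<^sup>2) - poly P (- x) * poly f ((x - 1)\<^sup>2)" for x
  proof -
    have "poly f ((x - 1)\<^sup>2) = poly f ((- x + 1)\<^sup>2)"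
      by (simp add: power2_eq_square algebra_simps)
    then have "poly P x * poly f ((x + 1)\<^sup>2) - poly P (- x) * poly f ((x - 1)\<^sup>2) =
        poly p x - poly p (- x)"
      by (simp add: p)
    also have "\<dots> = x * poly (smult 2 h) (x\<^sup>2)"
      unfolding gh by (simp add: algebra_simps)
    finally show ?thesis by simp
  qed
  have "shift_op P f = smult 2 h"
    by (rule shift_op_eqI) (rule *)
  then show ?thesis using * by simp
qed

lemma shift_op_add_left: "shift_op (P + Q) f = shift_op P f + shift_op Q f"
  by (rule shift_op_eqI) (simp add: distrib_left poly_shift_op, simp add: algebra_simps)

lemma shift_op_diff_left: "shift_op (P - Q) f = shift_op P f - shift_op Q f"
  by (rule shift_op_eqI) (simp add: right_diff_distrib poly_shift_op, simp add: algebra_simps)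

lemma shift_op_smult_left: "shift_op (smult r P) f = smult r (shift_op P f)"
  by (rule shift_op_eqI)
     (simp add: mult.left_commute[of _ r] poly_shift_op, simp add: algebra_simps)

lemma shift_op_uminus_left: "shift_op (- P) f = - shift_op P f"
  using shift_op_smult_left[of "- 1" P f] by simp

lemma shift_op_add_right: "shift_op P (f + g) = shift_op P f + shift_op P g"
  by (rule shift_op_eqI) (simp add: distrib_left poly_shift_op)

lemma shift_op_smult_right: "shift_op P (smult r f) = smult r (shift_op P f)"
  by (rule shift_op_eqI)
     (simp add: mult.left_commute[of _ r] poly_shift_op, simp add: algebra_simps)

lemma shift_op_sum_right: "shift_op P (\<Sum>k\<in>A. f k) = (\<Sum>k\<in>A. shift_op P (f k))"
proof (induction A rule: infinite_finite_induct)
  case (infinite A)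
  then show ?case using shift_op_smult_right[of P 0 0] by simp
next
  case empty
  then show ?case using shift_op_smult_right[of P 0 0] by simp
next
  case (insert k A)
  then show ?case by (simp add: shift_op_add_right)
qed

text \<open>Evaluating the inner operator at x + 1 and x - 1 produces three values of f, so products
  of two operators can be compared by three coefficients.\<close>

lemma poly_shift_op_twice:
  assumes "x \<noteq> 0" "x \<noteq> 1" "x \<noteq> - 1"
  shows "poly (shift_op P (shift_op Q f)) (x\<^sup>2) =
    poly P x * poly Q (x + 1) / (x * (x + 1)) * poly f ((x + 2)\<^sup>2)
    - (poly P x * poly Q (- 1 - x) / (x * (x + 1)) + poly P (- x) * poly Q (x - 1) / (x * (x - 1)))
        * poly f (x\<^sup>2)
    + poly P (- x) * poly Q (1 - x) / (x * (x - 1)) * poly f ((x - 2)\<^sup>2)"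
proof -
  have nz: "x + 1 \<noteq> 0" "x - 1 \<noteq> 0" using assms by (auto simp: eq_neg_iff_add_eq_0)
  have plus: "poly (shift_op Q f) ((x + 1)\<^sup>2) =
      (poly Q (x + 1) * poly f ((x + 2)\<^sup>2) - poly Q (- 1 - x) * poly f (x\<^sup>2)) / (x + 1)"
    using poly_shift_op[of "x + 1" Q f] nz by (simp add: eq_divide_eq ac_simps)
  have minus: "poly (shift_op Q f) ((x - 1)\<^sup>2) =
      (poly Q (x - 1) * poly f (x\<^sup>2) - poly Q (1 - x) * poly f ((x - 2)\<^sup>2)) / (x - 1)"
    using poly_shift_op[of "x - 1" Q f] nz by (simp add: eq_divide_eq ac_simps)
  have "poly (shift_op P (shift_op Q f)) (x\<^sup>2) =
      (poly P x * poly (shift_op Q f) ((x + 1)\<^sup>2)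
       - poly P (- x) * poly (shift_op Q f) ((x - 1)\<^sup>2)) / x"
    using poly_shift_op[of x P "shift_op Q f"] assms by (simp add: field_simps)
  then show ?thesis
    unfolding plus minus using nz assms(1)
    by (simp add: diff_divide_distrib add_divide_distrib algebra_simps)
qed

section \<open>Symbols of the four generators\<close>

fun sk_symbol :: "complex \<Rightarrow> sk_gen \<Rightarrow> complex poly" where
  "sk_symbol h G0 = - [:h, 2:]"
| "sk_symbol h G3 = smult (- 1 / 2) ([:h, 2:]\<^sup>2 + 1)"
| "sk_symbol h GPlus = smult (1 / 2) (([:h, 2:]\<^sup>2 - 1)\<^sup>2)"
| "sk_symbol h GMinus = [:- 1 / 2:]"

definition sk_op :: "complex \<Rightarrow> sk_gen \<Rightarrow> complex poly \<Rightarrow> complex poly" where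
  "sk_op h g = shift_op (sk_symbol h g)"

text \<open>After clearing denominators each relation is a polynomial identity in x, h and the
  values of v at (x + 2)^2, x^2 and (x - 2)^2. It holds for every h; the value e1 - 2 is chosen
  later to fit the Wilson polynomials.\<close>

lemma sk_generator_action_sk_op: "sk_generator_action smult (sk_op h)"
proof (intro sk_generator_action.intro sk_generator_action_axioms.intro)
  let ?T = "sk_op h"
  \<comment> \<open>The excluded points are the poles of the formula for two successive
    operators.\<close>
  have eqI: "p = q"
    if "\<And>x. x \<noteq> 0 \<Longrightarrow> x \<noteq> 1 \<Longrightarrow> x \<noteq> - 1 \<Longrightarrow> x + 1 \<noteq> 0 \<Longrightarrow> x - 1 \<noteq> 0 \<Longrightarrow>
      poly p (x\<^sup>2) = poly q (x\<^sup>2)" for p q :: "complex poly"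
    by (rule poly_square_eqI[of "{0, 1, - 1}"])
       (auto intro!: that simp: eq_neg_iff_add_eq_0)
  fix v :: "complex poly"
  show "?T G0 (?T GMinus v) - ?T GMinus (?T G0 v) = - smult 4 (?T GMinus (?T GMinus v))"
    by (rule eqI) (simp add: sk_op_def poly_shift_op_twice divide_simps, algebra)
  show "?T G0 (?T GPlus v) - ?T GPlus (?T G0 v) =
        smult 16 (?T G3 (?T GMinus v) + ?T GMinus (?T G3 v)) - smult 32 (?T GMinus (?T GMinus v))
        + smult 2 (?T GPlus (?T GMinus v) + ?T GMinus (?T GPlus v)) - smult 8 (?T G3 (?T G3 v))"
    by (rule eqI) (simp add: sk_op_def poly_shift_op_twice divide_simps, algebra)
  show "?T GPlus (?T GMinus v) - ?T GMinus (?T GPlus v) = smult 2 (?T G0 (?T G3 v) + ?T G3 (?T G0 v))"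
    by (rule eqI) (simp add: sk_op_def poly_shift_op_twice divide_simps, algebra)
  show "?T G0 (?T G3 v) - ?T G3 (?T G0 v) =
        smult 2 (?T G3 (?T GMinus v) + ?T GMinus (?T G3 v)) - smult 16 (?T GMinus (?T GMinus v))"
    by (rule eqI) (simp add: sk_op_def poly_shift_op_twice divide_simps, algebra)
  show "?T G3 (?T GPlus v) - ?T GPlus (?T G3 v) = ?T G0 (?T GPlus v) + ?T GPlus (?T G0 v)"
    by (rule eqI) (simp add: sk_op_def poly_shift_op_twice divide_simps, algebra)
  show "?T G3 (?T GMinus v) - ?T GMinus (?T G3 v) = - (?T G0 (?T GMinus v) + ?T GMinus (?T G0 v))"
    by (rule eqI) (simp add: sk_op_def poly_shift_op_twice divide_simps, algebra)
next
  show vs: "vector_space (smult :: complex \<Rightarrow> complex poly \<Rightarrow> complex poly)"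
    by unfold_locales (simp_all add: smult_add_right smult_add_left)
  show "Vector_Spaces.linear smult smult (sk_op h g)" for g
    by (simp add: Vector_Spaces.linear_iff vs sk_op_def shift_op_add_right shift_op_smult_right)
qed

section \<open>Ladder relations for the Wilson polynomials\<close>

definition wilson_basis :: "complex \<Rightarrow> nat \<Rightarrow> complex poly" where
  "wilson_basis a k = (\<Prod>j<k. [:(a + of_nat j)\<^sup>2, - 1 / 4:])"

text \<open>The arguments \<open>s, p, q, r\<close> stand for \<open>a + b + c + d\<close>, \<open>a + b\<close>, \<open>a + c\<close> and \<open>a + d\<close>.\<close>

definition wilson_coeff ::
    "nat \<Rightarrow> complex \<Rightarrow> complex \<Rightarrow> complex \<Rightarrow> complex \<Rightarrow> nat \<Rightarrow> complex" where
  "wilson_coeff n s p q r k =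
     pochhammer (- of_nat n) k * pochhammer (of_nat n + s - 1) k / fact k *
     pochhammer (p + of_nat k) (n - k) * pochhammer (q + of_nat k) (n - k) *
     pochhammer (r + of_nat k) (n - k)"

lemma wilson_scaled_eq_sum:
  "wilson_scaled a b c d n =
     (\<Sum>k\<le>n. smult (wilson_coeff n (a + b + c + d) (a + b) (a + c) (a + d) k) (wilson_basis a k))"
proof -
  have "poly (wilson_scaled a b c d n) y = poly (\<Sum>k\<le>n. smult
      (wilson_coeff n (a + b + c + d) (a + b) (a + c) (a + d) k) (wilson_basis a k)) y" for y
    by (simp add: wilson_scaled_def wilson_def wilson_coeff_def wilson_basis_def poly_pcompose
        poly_sum poly_prod add_diff_eq add.assoc)
  then show ?thesis by (simp add: poly_eq_poly_eq_iff[symmetric] fun_eq_iff)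
qed

lemma coeff_wilson_basis:
  "j > k \<Longrightarrow> coeff (wilson_basis a k) j = 0" "coeff (wilson_basis a k) k = (- 1 / 4) ^ k"
proof (induction k arbitrary: j)
  case 0
  case 1 then show ?case by (simp add: wilson_basis_def)
next
  case 0
  case 2 then show ?case by (simp add: wilson_basis_def)
next
  case (Suc k)
  have step: "wilson_basis a (Suc k) = [:(a + of_nat k)\<^sup>2, - 1 / 4:] * wilson_basis a k"
    by (simp add: wilson_basis_def mult.commute)
  case 1 with Suc show ?case by (cases j) (simp_all add: step)
next
  case (Suc k)
  have step: "wilson_basis a (Suc k) = [:(a + of_nat k)\<^sup>2, - 1 / 4:] * wilson_basis a k"
    by (simp add: wilson_basis_def mult.commute)
  case 2 from Suc show ?case by (simp add: step)
qed

text \<open>Only the last term of the expansion reaches degree n. This triangular form reduces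
  uniqueness to nonvanishing leading coefficients.\<close>

lemma coeff_wilson_scaled:
  "j > n \<Longrightarrow> coeff (wilson_scaled a b c d n) j = 0"
  "coeff (wilson_scaled a b c d n) n = pochhammer (of_nat n + a + b + c + d - 1) n / 4 ^ n"
proof -
  show "coeff (wilson_scaled a b c d n) j = 0" if "j > n"
    using that by (simp add: wilson_scaled_eq_sum coeff_sum coeff_wilson_basis)
  have "coeff (wilson_scaled a b c d n) n =
      (\<Sum>k\<le>n. if k = n then pochhammer (- of_nat n) n *
        pochhammer (of_nat n + (a + b + c + d) - 1) n / fact n * (- 1 / 4) ^ n else 0)"
    unfolding wilson_scaled_eq_sum coeff_sum
    by (intro sum.cong refl) (auto simp: coeff_wilson_basis wilson_coeff_def)
  \<comment> \<open>\<open>pochhammer (- of_nat n) n\<close> equals (-1)^n n!, which cancels the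
    factorial and the sign of (-1/4)^n.\<close>
  also have "\<dots> = pochhammer (of_nat n + a + b + c + d - 1) n / 4 ^ n"
    unfolding power_divide by (simp add: pochhammer_same add.assoc)
  finally show "coeff (wilson_scaled a b c d n) n =
      pochhammer (of_nat n + a + b + c + d - 1) n / 4 ^ n" .
qed

lemma poly_wilson_basis:
  "poly (wilson_basis a k) (x\<^sup>2) = pochhammer (a + x / 2) k * pochhammer (a - x / 2) k"
  by (induction k)
     (auto simp: wilson_basis_def pochhammer_Suc algebra_simps power2_eq_square)

text \<open>With u = a - 1/2 + x/2 and v = a - 1/2 - x/2 the two values are (u + 1)_k (v)_k and
  (u)_k (v + 1)_k, and x = u - v. The basis computations below use these coordinates.\<close>

lemma poly_wilson_basis_shift:
  "poly (wilson_basis a k) ((x + 1)\<^sup>2) =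
     pochhammer (a - 1 / 2 + x / 2 + 1) k * pochhammer (a - 1 / 2 - x / 2) k"
  "poly (wilson_basis a k) ((x - 1)\<^sup>2) =
     pochhammer (a - 1 / 2 + x / 2) k * pochhammer (a - 1 / 2 - x / 2 + 1) k"
  unfolding poly_wilson_basis by (simp_all add: add_divide_distrib diff_divide_distrib algebra_simps)

lemma pochhammer_shift:
  fixes w :: "'a::comm_semiring_1"
  shows "w * pochhammer (w + 1) k = (w + of_nat k) * pochhammer w k"
  by (metis pochhammer_Suc pochhammer_rec mult.commute)

section \<open>The four shift operators on the basis\<close>

definition half_factor :: "complex \<Rightarrow> complex poly" where
  "half_factor u = [:u - 1 / 2, 1 / 2:]"

lemma poly_half_factor: "poly (half_factor u) x = u - 1 / 2 + x / 2"
  by (simp add: half_factor_def)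

text \<open>For k = m + 1 the common factor (u + 1)_m (v + 1)_m leaves (u + 1 + m) v - u (v + 1 + m)
  = - k (u - v). For k = 0 the factor k vanishes, so the truncated index \<open>k - 1\<close> is
  harmless.\<close>

lemma shift_op_one_basis:
  "shift_op 1 (wilson_basis a k) = smult (- of_nat k) (wilson_basis (a + 1 / 2) (k - 1))"
proof (cases k)
  case 0
  show ?thesis by (rule shift_op_eqI) (simp add: 0 wilson_basis_def)
next
  case (Suc m)
  show ?thesis
  proof (rule shift_op_eqI)
    fix x :: complex
    define u v where uv: "u = a - 1 / 2 + x / 2" "v = a - 1 / 2 - x / 2"
    define U V where UV: "U = pochhammer (u + 1) m" "V = pochhammer (v + 1) m"
    have x: "x = u - v" by (simp add: uv)
    have upper: "a + 1 / 2 + x / 2 = u + 1" "a + 1 / 2 - x / 2 = v + 1"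
      by (simp_all add: uv)
    have basis: "poly (wilson_basis a k) ((x + 1)\<^sup>2) = U * (u + 1 + of_nat m) * (v * V)"
      "poly (wilson_basis a k) ((x - 1)\<^sup>2) = u * U * (V * (v + 1 + of_nat m))"
      "poly (wilson_basis (a + 1 / 2) m) (x\<^sup>2) = U * V"
      unfolding poly_wilson_basis_shift unfolding poly_wilson_basis upper Suc UV uv[symmetric]
      by (simp_all add: pochhammer_rec[of u] pochhammer_rec[of v] pochhammer_Suc[of "u + 1"]
          pochhammer_Suc[of "v + 1"])
    have k: "of_nat k = 1 + of_nat m" "k - 1 = m" by (simp_all add: Suc)
    show "x * poly (smult (- of_nat k) (wilson_basis (a + 1 / 2) (k - 1))) (x\<^sup>2) =
        poly 1 x * poly (wilson_basis a k) ((x + 1)\<^sup>2)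
        - poly 1 (- x) * poly (wilson_basis a k) ((x - 1)\<^sup>2)"
      unfolding poly_smult k basis poly_1 unfolding x by algebra
  qed
qed

text \<open>The factors for c and d are not absorbed by the Pochhammer symbols based at a, so two
  basis elements appear. The common factor (u + 1)_m (v + 1)_m leaves a polynomial identity in u, v,
  m, c - a and d - a.\<close>

lemma shift_op_mixed_basis:
  "shift_op (half_factor c * half_factor d) (wilson_basis a k) =
     smult (c + d - 1 + of_nat k) (wilson_basis (a + 1 / 2) k)
     - smult (of_nat k * (a + c - 1 + of_nat k) * (a + d - 1 + of_nat k))
        (wilson_basis (a + 1 / 2) (k - 1))"
proof (cases k)
  case 0
  show ?thesis
    by (rule shift_op_eqI) (simp add: 0 wilson_basis_def poly_half_factor field_simps)
next
  case (Suc m)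
  show ?thesis
  proof (rule shift_op_eqI)
    fix x :: complex
    let ?P = "half_factor c * half_factor d"
    define u v where uv: "u = a - 1 / 2 + x / 2" "v = a - 1 / 2 - x / 2"
    define U V where UV: "U = pochhammer (u + 1) m" "V = pochhammer (v + 1) m"
    define \<gamma> \<delta> where \<gamma>\<delta>: "\<gamma> = c - a" "\<delta> = d - a"
    have x: "x = u - v" by (simp add: uv)
    have params: "c + d - 1 = u + v + \<gamma> + \<delta>" "a + c - 1 = u + v + \<gamma>" "a + d - 1 = u + v + \<delta>"
      by (simp_all add: uv \<gamma>\<delta>)
    have half: "poly (half_factor w) x = u + (w - a)" "poly (half_factor w) (- x) = v + (w - a)"
      for w by (simp_all add: poly_half_factor uv)
    have P: "poly ?P x = (u + \<gamma>) * (u + \<delta>)" "poly ?P (- x) = (v + \<gamma>) * (v + \<delta>)"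
      by (simp_all add: half \<gamma>\<delta>)
    have upper: "a + 1 / 2 + x / 2 = u + 1" "a + 1 / 2 - x / 2 = v + 1"
      by (simp_all add: uv)
    have basis: "poly (wilson_basis a k) ((x + 1)\<^sup>2) = U * (u + 1 + of_nat m) * (v * V)"
      "poly (wilson_basis a k) ((x - 1)\<^sup>2) = u * U * (V * (v + 1 + of_nat m))"
      "poly (wilson_basis (a + 1 / 2) m) (x\<^sup>2) = U * V"
      "poly (wilson_basis (a + 1 / 2) k) (x\<^sup>2) =
        U * (u + 1 + of_nat m) * (V * (v + 1 + of_nat m))"
      unfolding poly_wilson_basis_shift unfolding poly_wilson_basis upper Suc UV uv[symmetric]
      by (simp_all add: pochhammer_rec[of u] pochhammer_rec[of v] pochhammer_Suc[of "u + 1"]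
          pochhammer_Suc[of "v + 1"])
    have k: "of_nat k = 1 + of_nat m" "k - 1 = m" by (simp_all add: Suc)
    show "x * poly (smult (c + d - 1 + of_nat k) (wilson_basis (a + 1 / 2) k)
       - smult (of_nat k * (a + c - 1 + of_nat k) * (a + d - 1 + of_nat k))
          (wilson_basis (a + 1 / 2) (k - 1))) (x\<^sup>2) =
        poly ?P x * poly (wilson_basis a k) ((x + 1)\<^sup>2)
        - poly ?P (- x) * poly (wilson_basis a k) ((x - 1)\<^sup>2)"
      unfolding poly_diff poly_smult k basis P params unfolding x by algebra
  qed
qed

text \<open>The factor for a is u at x and v at -x, and u (u + 1)_k = (u + k) (u)_k. What remains is
  (u + k)(u + \<beta>) - (v + k)(v + \<beta>) = (u - v)(u + v + \<beta> + k).\<close>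

lemma shift_op_diagonal_basis:
  "shift_op (half_factor a * half_factor b) (wilson_basis a k) =
     smult (a + b - 1 + of_nat k) (wilson_basis (a - 1 / 2) k)"
proof (rule shift_op_eqI)
  fix x :: complex
  let ?P = "half_factor a * half_factor b"
  define u v where uv: "u = a - 1 / 2 + x / 2" "v = a - 1 / 2 - x / 2"
  define U V where UV: "U = pochhammer u k" "V = pochhammer v k"
  define U' V' where U'V': "U' = pochhammer (u + 1) k" "V' = pochhammer (v + 1) k"
  define \<beta> where \<beta>: "\<beta> = b - a"
  have shift: "u * U' = (u + of_nat k) * U" "v * V' = (v + of_nat k) * V"
    unfolding UV U'V' by (rule pochhammer_shift)+
  have x: "x = u - v" by (simp add: uv)
  have params: "a + b - 1 = u + v + \<beta>" by (simp add: uv \<beta>)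
  have half: "poly (half_factor w) x = u + (w - a)" "poly (half_factor w) (- x) = v + (w - a)"
    for w by (simp_all add: poly_half_factor uv)
  have P: "poly ?P x = u * (u + \<beta>)" "poly ?P (- x) = v * (v + \<beta>)"
    by (simp_all add: half \<beta>)
  have basis: "poly (wilson_basis a k) ((x + 1)\<^sup>2) = U' * V"
      "poly (wilson_basis a k) ((x - 1)\<^sup>2) = U * V'"
      "poly (wilson_basis (a - 1 / 2) k) (x\<^sup>2) = U * V"
    unfolding poly_wilson_basis_shift unfolding poly_wilson_basis UV U'V' uv by simp_all
  show "x * poly (smult (a + b - 1 + of_nat k) (wilson_basis (a - 1 / 2) k)) (x\<^sup>2) =
      poly ?P x * poly (wilson_basis a k) ((x + 1)\<^sup>2)
      - poly ?P (- x) * poly (wilson_basis a k) ((x - 1)\<^sup>2)"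
    unfolding poly_smult basis P params unfolding x using shift by algebra
qed

text \<open>The factor for a is absorbed as in the case of a and b alone. Removing (u)_k (v)_k
  leaves u - v times a cubic; its part with (u + k)(v + k) gives the index k + 1, and v = - k
  isolates the other coefficient.\<close>

lemma shift_op_raising_basis:
  "shift_op (half_factor a * half_factor b * half_factor c * half_factor d) (wilson_basis a k) =
     smult ((a + b - 1 + of_nat k) * (a + c - 1 + of_nat k) * (a + d - 1 + of_nat k))
        (wilson_basis (a - 1 / 2) k)
     - smult (a + b + c + d - 2 + of_nat k) (wilson_basis (a - 1 / 2) (Suc k))"
proof (rule shift_op_eqI)
  fix x :: complex
  let ?P = "half_factor a * half_factor b * half_factor c * half_factor d"
  define u v where uv: "u = a - 1 / 2 + x / 2" "v = a - 1 / 2 - x / 2"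
  define U V where UV: "U = pochhammer u k" "V = pochhammer v k"
  define U' V' where U'V': "U' = pochhammer (u + 1) k" "V' = pochhammer (v + 1) k"
  define \<beta> \<gamma> \<delta> where \<beta>\<gamma>\<delta>: "\<beta> = b - a" "\<gamma> = c - a" "\<delta> = d - a"
  have shift: "u * U' = (u + of_nat k) * U" "v * V' = (v + of_nat k) * V"
    unfolding UV U'V' by (rule pochhammer_shift)+
  have x: "x = u - v" by (simp add: uv)
  have params: "a + b - 1 = u + v + \<beta>" "a + c - 1 = u + v + \<gamma>" "a + d - 1 = u + v + \<delta>"
    "a + b + c + d - 2 = u + v + u + v + \<beta> + \<gamma> + \<delta>"
    by (simp_all add: uv \<beta>\<gamma>\<delta>)
  have half: "poly (half_factor w) x = u + (w - a)" "poly (half_factor w) (- x) = v + (w - a)"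
    for w by (simp_all add: poly_half_factor uv)
  have P: "poly ?P x = u * (u + \<beta>) * (u + \<gamma>) * (u + \<delta>)"
    "poly ?P (- x) = v * (v + \<beta>) * (v + \<gamma>) * (v + \<delta>)"
    by (simp_all add: half \<beta>\<gamma>\<delta>)
  have basis: "poly (wilson_basis a k) ((x + 1)\<^sup>2) = U' * V"
      "poly (wilson_basis a k) ((x - 1)\<^sup>2) = U * V'"
      "poly (wilson_basis (a - 1 / 2) k) (x\<^sup>2) = U * V"
      "poly (wilson_basis (a - 1 / 2) (Suc k)) (x\<^sup>2) =
        U * (u + of_nat k) * (V * (v + of_nat k))"
    unfolding poly_wilson_basis_shift unfolding poly_wilson_basis UV U'V' uv
    by (simp_all add: pochhammer_Suc)
  have "x * poly (smult ((a + b - 1 + of_nat k) * (a + c - 1 + of_nat k) * (a + d - 1 + of_nat k))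
        (wilson_basis (a - 1 / 2) k)
      - smult (a + b + c + d - 2 + of_nat k) (wilson_basis (a - 1 / 2) (Suc k))) (x\<^sup>2) =
      (u + \<beta>) * (u + \<gamma>) * (u + \<delta>) * ((u + of_nat k) * U) * V
      - (v + \<beta>) * (v + \<gamma>) * (v + \<delta>) * ((v + of_nat k) * V) * U"
    unfolding poly_diff poly_smult basis P params unfolding x by algebra
  also have "\<dots> = poly ?P x * poly (wilson_basis a k) ((x + 1)\<^sup>2)
      - poly ?P (- x) * poly (wilson_basis a k) ((x - 1)\<^sup>2)"
    unfolding basis P shift[symmetric] by (simp only: mult_ac)
  finally show "x * poly (smult ((a + b - 1 + of_nat k) * (a + c - 1 + of_nat k) * (a + d - 1 + of_nat k))
        (wilson_basis (a - 1 / 2) k)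
      - smult (a + b + c + d - 2 + of_nat k) (wilson_basis (a - 1 / 2) (Suc k))) (x\<^sup>2) =
      poly ?P x * poly (wilson_basis a k) ((x + 1)\<^sup>2)
      - poly ?P (- x) * poly (wilson_basis a k) ((x - 1)\<^sup>2)" .
qed

section \<open>Recurrences for the expansion coefficients\<close>

lemma wilson_coeff_Suc_self: "wilson_coeff n s p q r (Suc n) = 0"
  by (simp add: wilson_coeff_def pochhammer_of_nat_eq_0_lemma)

text \<open>The first factors of (-n-1)_(k+1) and (n+s)_(k+1) are split off, and k + 1 cancels in
  the factorial. \<open>s\<close> grows by 2 and \<open>p\<close>, \<open>q\<close>,
  \<open>r\<close> by 1 since all four parameters grow by 1/2.\<close>

lemma wilson_coeff_lowering:
  "- of_nat (Suc k) * wilson_coeff (Suc n) s p q r (Suc k) =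
     of_nat (Suc n) * (of_nat (Suc n) + s - 1) * wilson_coeff n (s + 2) (p + 1) (q + 1) (r + 1) k"
proof -
  have 1: "pochhammer (- of_nat (Suc n)) (Suc k) =
      - of_nat (Suc n) * pochhammer (- of_nat n :: complex) k"
    by (subst pochhammer_rec) simp
  have 2: "pochhammer (of_nat (Suc n) + s - 1) (Suc k) =
      (of_nat (Suc n) + s - 1) * pochhammer (of_nat n + (s + 2) - 1) k"
    by (subst pochhammer_rec) (simp add: algebra_simps)
  have 3: "u + of_nat (Suc k) = u + 1 + of_nat k" for u :: complex by simp
  have 4: "- of_nat (Suc k) * (x / fact (Suc k)) = - (x / fact k)" for x :: complex
    using of_nat_neq_0[of k, where 'a = complex]
    by (simp add: fact_Suc del: of_nat_Suc)
  have "- of_nat (Suc k) * wilson_coeff (Suc n) s p q r (Suc k) =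
     - of_nat (Suc k) * (pochhammer (- of_nat (Suc n)) (Suc k) *
       pochhammer (of_nat (Suc n) + s - 1) (Suc k) / fact (Suc k)) *
     pochhammer (p + of_nat (Suc k)) (n - k) * pochhammer (q + of_nat (Suc k)) (n - k) *
     pochhammer (r + of_nat (Suc k)) (n - k)"
    by (simp add: wilson_coeff_def mult.assoc del: of_nat_Suc)
  also have "\<dots> = of_nat (Suc n) * (of_nat (Suc n) + s - 1) *
      wilson_coeff n (s + 2) (p + 1) (q + 1) (r + 1) k"
    unfolding 4 unfolding 1 2 3 by (simp add: wilson_coeff_def del: of_nat_Suc)
  finally show ?thesis .
qed

text \<open>Only the factor in \<open>p\<close> changes: lowering a, b and raising c, d by 1/2
  preserves a + b + c + d, a + c and a + d.\<close>

lemma wilson_coeff_diagonal: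
  assumes "k \<le> n"
  shows "(p - 1 + of_nat k) * wilson_coeff n s p q r k =
     (of_nat n + p - 1) * wilson_coeff n s (p - 1) q r k"
proof -
  have "(p - 1 + of_nat k) * pochhammer (p + of_nat k) (n - k) =
      (of_nat n + p - 1) * pochhammer (p - 1 + of_nat k) (n - k)"
    using pochhammer_shift[of "p - 1 + of_nat k" "n - k"] assms by (simp add: of_nat_diff algebra_simps)
  then show ?thesis by (simp add: wilson_coeff_def)
qed

text \<open>Splitting off the first or the last factor leaves the same core, so that neighbouring
  coefficients get a common factor.\<close>

lemma pochhammer_split_ends:
  fixes w :: complex
  assumes "k < n"
  shows "pochhammer (w + of_nat k) (n - k) =
      (w + of_nat k) * pochhammer (w + of_nat (Suc k)) (n - Suc k)"
    and "pochhammer (w + 1 + of_nat k) (n - k) =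
      (w + of_nat n) * pochhammer (w + of_nat (Suc k)) (n - Suc k)"
proof -
  obtain m where n: "n = k + Suc m" using assms by (metis less_iff_Suc_add add_Suc_right)
  show "pochhammer (w + of_nat k) (n - k) =
      (w + of_nat k) * pochhammer (w + of_nat (Suc k)) (n - Suc k)"
    by (simp add: n pochhammer_rec ac_simps)
  show "pochhammer (w + 1 + of_nat k) (n - k) =
      (w + of_nat n) * pochhammer (w + of_nat (Suc k)) (n - Suc k)"
    by (simp add: n pochhammer_Suc ac_simps)
qed

text \<open>Expressing the next coefficient by \<open>wilson_coeff n s p q r k\<close> itself would
  mean dividing by (p + k)(q + k)(r + k), which may vanish; the common factor of both avoids
  this.\<close>

lemma wilson_coeff_Suc:
  assumes "k < n"
  defines "X \<equiv> \<lambda>w. pochhammer (w + of_nat (Suc k)) (n - Suc k)"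
  shows "of_nat (Suc k) * wilson_coeff n s p q r (Suc k) =
    (of_nat k - of_nat n) * (of_nat n + s - 1 + of_nat k) *
    (pochhammer (- of_nat n) k * pochhammer (of_nat n + s - 1) k / fact k * X p * X q * X r)"
proof -
  have fact: "of_nat (Suc k) * (y / fact (Suc k)) = y / fact k" for y :: complex
    by (simp add: fact_Suc del: of_nat_Suc)
  have "of_nat (Suc k) * wilson_coeff n s p q r (Suc k) =
    of_nat (Suc k) * ((pochhammer (- of_nat n) (Suc k) *
      pochhammer (of_nat n + s - 1) (Suc k)) / fact (Suc k))
      * X p * X q * X r"
    by (simp only: wilson_coeff_def X_def mult.assoc)
  also have "\<dots> = (of_nat k - of_nat n) * (of_nat n + s - 1 + of_nat k) *
    (pochhammer (- of_nat n) k * pochhammer (of_nat n + s - 1) k / fact k * X p * X q * X r)"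
    unfolding fact pochhammer_Suc by (simp add: ac_simps)
  finally show ?thesis .
qed

lemma wilson_coeff_mixed:
  assumes "k \<le> n"
  shows "(s - p - 1 + of_nat k) * wilson_coeff n s p q r k
      - of_nat (Suc k) * (q + of_nat k) * (r + of_nat k) * wilson_coeff n s p q r (Suc k) =
    (of_nat n + s - p - 1) * wilson_coeff n s (p + 1) q r k"
proof (cases "k = n")
  case True
  then show ?thesis by (simp only: wilson_coeff_Suc_self) (simp add: wilson_coeff_def)
next
  case False
  with assms have "k < n" by simp
  note split = pochhammer_split_ends[OF this]
  define X where "X = (\<lambda>w :: complex. pochhammer (w + of_nat (Suc k)) (n - Suc k))"
  define C where "C = pochhammer (- of_nat n) k * pochhammer (of_nat n + s - 1) k / fact k
    * X p * X q * X r"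
  have "of_nat (Suc k) * wilson_coeff n s p q r (Suc k) =
      (of_nat k - of_nat n) * (of_nat n + s - 1 + of_nat k) * C"
    unfolding C_def X_def by (rule wilson_coeff_Suc) fact
  moreover have "wilson_coeff n s p q r k = (p + of_nat k) * (q + of_nat k) * (r + of_nat k) * C"
    unfolding wilson_coeff_def split C_def X_def by (simp only: ac_simps)
  moreover have "wilson_coeff n s (p + 1) q r k =
      (p + of_nat n) * (q + of_nat k) * (r + of_nat k) * C"
    unfolding wilson_coeff_def split(2)[of p] split(1)[of q] split(1)[of r] C_def X_def
    by (simp only: ac_simps)
  \<comment> \<open>Up to (q + k)(r + k) C this is (s - p - 1 + k)(p + k) - (k - n)(n + s - 1 + k) =
    (n + s - p - 1)(p + n).\<close>
  ultimately show ?thesis by algebra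
qed

lemma wilson_coeff_raising_0:
  "wilson_coeff (Suc n) (s - 2) (p - 1) (q - 1) (r - 1) 0 =
     (p - 1) * (q - 1) * (r - 1) * wilson_coeff n s p q r 0"
  by (simp add: wilson_coeff_def pochhammer_rec)

text \<open>Multiplied by k + 1, all terms are multiples of the coefficient at k, and the identity
  is (k - n)(n + s - 1 + k) - (k + 1)(s - 2 + k) = - (n + 1)(n + s - 2).\<close>

lemma wilson_coeff_raising_Suc:
  assumes "k \<le> n"
  shows "wilson_coeff (Suc n) (s - 2) (p - 1) (q - 1) (r - 1) (Suc k) =
     (p + of_nat k) * (q + of_nat k) * (r + of_nat k) * wilson_coeff n s p q r (Suc k)
     - (s - 2 + of_nat k) * wilson_coeff n s p q r k"
proof -
  define E where "E = wilson_coeff n s p q r k"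
  have "of_nat (Suc k) * wilson_coeff (Suc n) (s - 2) (p - 1) (q - 1) (r - 1) (Suc k) =
      - (of_nat n + 1) * (of_nat n + s - 2) * E"
  proof -
    have "- of_nat (Suc k) * wilson_coeff (Suc n) (s - 2) (p - 1) (q - 1) (r - 1) (Suc k) =
      of_nat (Suc n) * (of_nat (Suc n) + (s - 2) - 1) * E"
      unfolding wilson_coeff_lowering E_def by simp
    then show ?thesis by (simp add: algebra_simps)
  qed
  moreover have "of_nat (Suc k) * ((p + of_nat k) * (q + of_nat k) * (r + of_nat k)
      * wilson_coeff n s p q r (Suc k)) = (of_nat k - of_nat n) * (of_nat n + s - 1 + of_nat k) * E"
  proof (cases "k = n")
    case True
    then show ?thesis by (simp only: wilson_coeff_Suc_self) simp
  next
    case False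
    with assms have "k < n" by simp
    note split = pochhammer_split_ends[OF this]
    define C where "C = pochhammer (- of_nat n) k * pochhammer (of_nat n + s - 1) k / fact k
      * pochhammer (p + of_nat (Suc k)) (n - Suc k) * pochhammer (q + of_nat (Suc k)) (n - Suc k)
      * pochhammer (r + of_nat (Suc k)) (n - Suc k)"
    have "of_nat (Suc k) * wilson_coeff n s p q r (Suc k) =
        (of_nat k - of_nat n) * (of_nat n + s - 1 + of_nat k) * C"
      unfolding C_def by (rule wilson_coeff_Suc) fact
    moreover have "E = (p + of_nat k) * (q + of_nat k) * (r + of_nat k) * C"
      unfolding E_def wilson_coeff_def split C_def by (simp only: ac_simps)
    ultimately show ?thesis by algebra
  qed
  ultimately have "of_nat (Suc k) * wilson_coeff (Suc n) (s - 2) (p - 1) (q - 1) (r - 1) (Suc k) =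
      of_nat (Suc k) * ((p + of_nat k) * (q + of_nat k) * (r + of_nat k) * wilson_coeff n s p q r (Suc k)
     - (s - 2 + of_nat k) * E)"
    unfolding of_nat_Suc by algebra
  then show ?thesis
    unfolding E_def by (metis mult_left_cancel of_nat_neq_0)
qed

section \<open>Ladder relations by comparison of coefficients\<close>

lemma smult_sum_right: "smult c (\<Sum>k\<in>A. f k) = (\<Sum>k\<in>A. smult c (f k))"
  by (induction A rule: infinite_finite_induct) (simp_all add: smult_add_right)

lemma shift_op_wilson_scaled:
  "shift_op P (wilson_scaled a b c d n) = (\<Sum>k\<le>n. smult
     (wilson_coeff n (a + b + c + d) (a + b) (a + c) (a + d) k) (shift_op P (wilson_basis a k)))"
  by (simp add: wilson_scaled_eq_sum shift_op_sum_right shift_op_smult_right)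

lemma wilson_lowering:
  "shift_op 1 (wilson_scaled a b c d n) =
     smult (of_nat n * (of_nat n + (a + b + c + d) - 1))
       (wilson_scaled (a + 1 / 2) (b + 1 / 2) (c + 1 / 2) (d + 1 / 2) (n - 1))"
proof (cases n)
  case 0
  then show ?thesis by (simp add: shift_op_wilson_scaled shift_op_one_basis)
next
  case (Suc m)
  let ?c = "wilson_coeff n (a + b + c + d) (a + b) (a + c) (a + d)"
  have params: "a + 1 / 2 + (b + 1 / 2) + (c + 1 / 2) + (d + 1 / 2) = a + b + c + d + 2"
    "a + 1 / 2 + (b + 1 / 2) = a + b + 1" "a + 1 / 2 + (c + 1 / 2) = a + c + 1"
    "a + 1 / 2 + (d + 1 / 2) = a + d + 1"
    by simp_all
  have "shift_op 1 (wilson_scaled a b c d n) =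
      (\<Sum>k\<le>m. smult (- of_nat (Suc k) * ?c (Suc k)) (wilson_basis (a + 1 / 2) k))"
    unfolding shift_op_wilson_scaled shift_op_one_basis smult_smult Suc
    \<comment> \<open>The term k = 0 carries the factor k and drops out.\<close>
    by (subst sum.atMost_Suc_shift) (simp add: mult.commute)
  then show ?thesis
    unfolding Suc wilson_coeff_lowering diff_Suc_1 wilson_scaled_eq_sum smult_sum_right smult_smult
    \<comment> \<open>The sum of all four parameters contains a + 1/2 + (b + 1/2) as a subterm and
      is therefore rewritten first.\<close>
    unfolding params(1) unfolding params(2-4) .
qed

lemma wilson_diagonal:
  "shift_op (half_factor a * half_factor b) (wilson_scaled a b c d n) =
     smult (of_nat n + a + b - 1)
       (wilson_scaled (a - 1 / 2) (b - 1 / 2) (c + 1 / 2) (d + 1 / 2) n)"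
proof -
  have params: "a - 1 / 2 + (b - 1 / 2) + (c + 1 / 2) + (d + 1 / 2) = a + b + c + d"
    "a - 1 / 2 + (b - 1 / 2) = a + b - 1" "a - 1 / 2 + (c + 1 / 2) = a + c"
    "a - 1 / 2 + (d + 1 / 2) = a + d"
    by simp_all
  show ?thesis
    unfolding shift_op_wilson_scaled shift_op_diagonal_basis
    unfolding wilson_scaled_eq_sum smult_sum_right smult_smult params(1)
    unfolding params(2-4)
    by (intro sum.cong refl)
       (simp add: wilson_coeff_diagonal mult.commute[of "wilson_coeff _ _ _ _ _ _"] add.assoc)
qed

text \<open>Each basis element arises from the terms k and k + 1 of the expansion; after reindexing,
  their coefficients combine by \<open>wilson_coeff_mixed\<close>.\<close>

lemma wilson_mixed:
  "shift_op (half_factor c * half_factor d) (wilson_scaled a b c d n) =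
     smult (of_nat n + c + d - 1)
       (wilson_scaled (a + 1 / 2) (b + 1 / 2) (c - 1 / 2) (d - 1 / 2) n)"
proof -
  let ?c = "wilson_coeff n (a + b + c + d) (a + b) (a + c) (a + d)"
  let ?\<phi> = "wilson_basis (a + 1 / 2)"
  have params: "a + 1 / 2 + (b + 1 / 2) + (c - 1 / 2) + (d - 1 / 2) = a + b + c + d"
    "a + 1 / 2 + (b + 1 / 2) = a + b + 1" "a + 1 / 2 + (c - 1 / 2) = a + c"
    "a + 1 / 2 + (d - 1 / 2) = a + d"
    by simp_all
  define g where "g k = smult (of_nat k * (a + c - 1 + of_nat k) * (a + d - 1 + of_nat k) * ?c k)
    (?\<phi> (k - 1))" for k
  \<comment> \<open>The term at \<open>Suc n\<close> vanishes because the series terminates, and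
    \<open>g 0\<close> because of its factor k, so the shift leaves no boundary term.\<close>
  have "(\<Sum>k\<le>n. g k) = (\<Sum>k\<le>Suc n. g k)"
    by (simp add: g_def wilson_coeff_Suc_self)
  also have "\<dots> = (\<Sum>k\<le>n. g (Suc k))"
    by (subst sum.atMost_Suc_shift) (simp add: g_def)
  finally have g: "(\<Sum>k\<le>n. g k) = (\<Sum>k\<le>n. g (Suc k))" .
  have "shift_op (half_factor c * half_factor d) (wilson_scaled a b c d n) =
      (\<Sum>k\<le>n. smult ((c + d - 1 + of_nat k) * ?c k) (?\<phi> k)) - (\<Sum>k\<le>n. g k)"
    unfolding shift_op_wilson_scaled shift_op_mixed_basis g_def
    by (simp add: smult_diff_right sum_subtractf ac_simps)
  also have "\<dots> = (\<Sum>k\<le>n. smult ((of_nat n + c + d - 1) *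
      wilson_coeff n (a + b + c + d) (a + b + 1) (a + c) (a + d) k) (?\<phi> k))"
    unfolding g sum_subtractf[symmetric]
  proof (intro sum.cong refl)
    fix k assume "k \<in> {..n}"
    then have k: "k \<le> n" by simp
    have index: "w - 1 + of_nat (Suc k) = w + of_nat k" for w :: complex by simp
    have "a + b + c + d - (a + b) - 1 = c + d - 1"
      "of_nat n + (a + b + c + d) - (a + b) - 1 = of_nat n + c + d - 1" by simp_all
    note mixed = wilson_coeff_mixed[OF k, of "a + b + c + d" "a + b" "a + c" "a + d", unfolded this]
    show "smult ((c + d - 1 + of_nat k) * ?c k) (?\<phi> k) - g (Suc k) =
        smult ((of_nat n + c + d - 1) *
          wilson_coeff n (a + b + c + d) (a + b + 1) (a + c) (a + d) k) (?\<phi> k)"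
      unfolding g_def index diff_Suc_1 smult_diff_left[symmetric] mixed ..
  qed
  finally show ?thesis
    unfolding wilson_scaled_eq_sum smult_sum_right smult_smult params(1) unfolding params(2-4) .
qed

lemma wilson_raising:
  "shift_op (half_factor a * half_factor b * half_factor c * half_factor d)
      (wilson_scaled a b c d n) =
    wilson_scaled (a - 1 / 2) (b - 1 / 2) (c - 1 / 2) (d - 1 / 2) (Suc n)"
proof -
  let ?c = "wilson_coeff n (a + b + c + d) (a + b) (a + c) (a + d)"
  let ?c' = "wilson_coeff (Suc n) (a + b + c + d - 2) (a + b - 1) (a + c - 1) (a + d - 1)"
  let ?\<phi> = "wilson_basis (a - 1 / 2)"
  have params: "a - 1 / 2 + (b - 1 / 2) + (c - 1 / 2) + (d - 1 / 2) = a + b + c + d - 2"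
    "a - 1 / 2 + (b - 1 / 2) = a + b - 1" "a - 1 / 2 + (c - 1 / 2) = a + c - 1"
    "a - 1 / 2 + (d - 1 / 2) = a + d - 1"
    by simp_all
  \<comment> \<open>Here \<open>g 0\<close> need not vanish: it alone gives the coefficient at index
    0, while two neighbouring terms combine at each index k + 1.\<close>
  define g where "g k = smult ((a + b - 1 + of_nat k) * (a + c - 1 + of_nat k) *
    (a + d - 1 + of_nat k) * ?c k) (?\<phi> k)" for k
  have "(\<Sum>k\<le>n. g k) = (\<Sum>k\<le>Suc n. g k)"
    by (simp add: g_def wilson_coeff_Suc_self)
  also have "\<dots> = g 0 + (\<Sum>k\<le>n. g (Suc k))"
    by (rule sum.atMost_Suc_shift)
  finally have g: "(\<Sum>k\<le>n. g k) = g 0 + (\<Sum>k\<le>n. g (Suc k))" .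
  have step: "(\<Sum>k\<le>n. g (Suc k)) - (\<Sum>k\<le>n. smult ((a + b + c + d - 2 + of_nat k) * ?c k)
      (?\<phi> (Suc k))) = (\<Sum>k\<le>n. smult (?c' (Suc k)) (?\<phi> (Suc k)))"
    unfolding sum_subtractf[symmetric]
  proof (intro sum.cong refl)
    fix k assume "k \<in> {..n}"
    then have k: "k \<le> n" by simp
    have index: "w - 1 + of_nat (Suc k) = w + of_nat k" for w :: complex by simp
    show "g (Suc k) - smult ((a + b + c + d - 2 + of_nat k) * ?c k) (?\<phi> (Suc k)) =
        smult (?c' (Suc k)) (?\<phi> (Suc k))"
      unfolding g_def index smult_diff_left[symmetric] wilson_coeff_raising_Suc[OF k] ..
  qed
  have "shift_op (half_factor a * half_factor b * half_factor c * half_factor d)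
        (wilson_scaled a b c d n) =
      (\<Sum>k\<le>n. g k) - (\<Sum>k\<le>n. smult ((a + b + c + d - 2 + of_nat k) * ?c k) (?\<phi> (Suc k)))"
    unfolding shift_op_wilson_scaled shift_op_raising_basis g_def
    by (simp add: smult_diff_right sum_subtractf ac_simps)
  also have "\<dots> = g 0 + (\<Sum>k\<le>n. smult (?c' (Suc k)) (?\<phi> (Suc k)))"
    unfolding g step[symmetric] by (rule add_diff_eq[symmetric])
  also have "g 0 = smult (?c' 0) (?\<phi> 0)"
    by (simp add: g_def wilson_coeff_raising_0)
  also have "smult (?c' 0) (?\<phi> 0) + (\<Sum>k\<le>n. smult (?c' (Suc k)) (?\<phi> (Suc k))) =
      (\<Sum>k\<le>Suc n. smult (?c' k) (?\<phi> k))"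
    by (rule sum.atMost_Suc_shift[symmetric])
  finally show ?thesis
    unfolding wilson_scaled_eq_sum params(1) unfolding params(2-4) .
qed

section \<open>Uniqueness and the symbols of the generators\<close>

text \<open>Induction on a degree bound: subtracting a multiple of \<open>W n\<close> removes the
  coefficient of degree n.\<close>

lemma linear_eq_on_triangular_family:
  fixes f g :: "'a::field poly \<Rightarrow> 'a poly" and W :: "nat \<Rightarrow> 'a poly"
  assumes f: "Vector_Spaces.linear smult smult f" and g: "Vector_Spaces.linear smult smult g"
    and lead: "\<And>n. coeff (W n) n \<noteq> 0" and deg: "\<And>n k. n < k \<Longrightarrow> coeff (W n) k = 0"
    and eq: "\<And>n. f (W n) = g (W n)"
  shows "f = g"
proof
  have add: "f (p + q) = f p + f q" "g (p + q) = g p + g q"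
    and scale: "f (smult r p) = smult r (f p)" "g (smult r p) = smult r (g p)" for p q r
    using f g by (auto simp: Vector_Spaces.linear_iff)
  have *: "f p = g p" if "\<forall>k\<ge>n. coeff p k = 0" for p n
    using that
  proof (induction n arbitrary: p)
    case 0
    then have "p = smult 0 p" by (simp add: poly_eq_iff)
    then show ?case using scale[of 0 p] by simp
  next
    case (Suc n)
    define r where "r = coeff p n / coeff (W n) n"
    define q where "q = p - smult r (W n)"
    have "coeff q k = 0" if "k \<ge> n" for k
      using that Suc.prems lead[of n] deg[of n k] by (cases "k = n") (auto simp: q_def r_def)
    then have "f q = g q" using Suc.IH by blast
    moreover have "p = q + smult r (W n)" by (simp add: q_def)
    ultimately show ?case by (metis add scale eq)
  qed
  show "f p = g p" for p
    using *[of "Suc (degree p)" p] by (simp add: coeff_eq_0)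
qed

text \<open>Each factor is u + (x - 1)/2, so powers of x - 1 give coefficients that are elementary
  symmetric in u and v.\<close>

lemma half_factor_product:
  "half_factor u * half_factor v =
     smult (u * v) 1 + smult ((u + v) / 2) [:- 1, 1:] + smult (1 / 4) ([:- 1, 1:]\<^sup>2)"
  by (simp add: half_factor_def power2_eq_square field_simps)

context
  fixes a b c d e1 \<sigma> :: complex
  assumes e1: "e1 = a + b + c + d" and \<sigma>: "\<sigma> * (a + b - c - d) = 1"
begin

text \<open>The quadratic terms of the two products cancel, and \<sigma> normalises the linear term
  to (x - 1)/2. Symbols with an odd part are reached in this way.\<close>

lemma sigma_half_factor_diff:
  "smult \<sigma> (half_factor a * half_factor b - half_factor c * half_factor d) =
     smult (\<sigma> * (a * b - c * d)) 1 + [:- 1 / 2, 1 / 2:]"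
proof -
  have "smult \<sigma> (half_factor a * half_factor b - half_factor c * half_factor d) =
      smult (\<sigma> * (a * b - c * d)) 1 + smult (\<sigma> * (a + b - c - d)) [:- 1 / 2, 1 / 2:]"
    unfolding half_factor_product by (simp add: field_simps)
  then show ?thesis by (simp add: \<sigma>)
qed

lemma sk_symbol_0:
  "sk_symbol (e1 - 2) G0 = smult (4 * \<sigma>) (half_factor c * half_factor d)
     + smult (4 * \<sigma> * (a * b - c * d) - e1) 1 - smult (4 * \<sigma>) (half_factor a * half_factor b)"
proof -
  let ?A = "half_factor a * half_factor b" and ?C = "half_factor c * half_factor d"
  have "smult (4 * \<sigma>) ?C + smult (4 * \<sigma> * (a * b - c * d) - e1) 1 - smult (4 * \<sigma>) ?A =
      smult (4 * \<sigma> * (a * b - c * d) - e1) 1 - smult 4 (smult \<sigma> (?A - ?C))"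
    by (simp add: smult_diff_right)
  then show ?thesis
    unfolding sigma_half_factor_diff by simp
qed

text \<open>Since s = e1 + 2 (x - 1), s^2 is 8 times the sum of the two products plus the constant
  e1^2 - 8 (a b + c d).\<close>

lemma sk_symbol_3:
  "sk_symbol (e1 - 2) G3 = - smult 4 (half_factor a * half_factor b)
     + smult (1 / 2 * (8 * (a * b + c * d) - e1 ^ 2 - 1)) 1 - smult 4 (half_factor c * half_factor d)"
  unfolding half_factor_product e1 by (simp add: power2_eq_square field_simps one_pCons)

text \<open>With z = (x - 1)/2 one has s = e1 + 4 z, and the quartic is matched by degree: the full
  product accounts for degrees 4 and 3, \<alpha> for degree 2, \<beta> for degree 1 and \<xi> for
  the constant.\<close>

lemma sk_symbol_plus:
  fixes e2 e3 e4 \<alpha> \<beta> \<xi> :: complex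
  assumes e2: "e2 = a * b + a * c + a * d + b * c + b * d + c * d"
    and e3: "e3 = a * b * c + a * b * d + a * c * d + b * c * d"
    and e4: "e4 = a * b * c * d"
    and \<alpha>: "\<alpha> = 1 / 2 * e1 ^ 2 - 4 / 3 * e2"
    and \<beta>: "\<beta> = - (e1 ^ 3) + 4 * e2 * e1 - 8 * e3"
    and \<xi>: "\<xi> = 1 / 16 * (1 - 2 * e1 ^ 2 + e1 ^ 4 - 256 * e4)"
  shows "sk_symbol (e1 - 2) GPlus =
     smult 128 (half_factor a * half_factor b * half_factor c * half_factor d)
     + smult (8 * (6 * \<alpha> - 1 + 2 * \<beta> * \<sigma>)) (half_factor a * half_factor b)
     + smult (8 * (6 * \<alpha> - 1 - 2 * \<beta> * \<sigma>)) (half_factor c * half_factor d)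
     + smult (8 * ((1 - 6 * \<alpha>) * (a * b + c * d) - 2 * \<beta> * \<sigma> * (a * b - c * d) + \<xi>)) 1"
    (is "_ = ?R")
proof -
  let ?A = "half_factor a * half_factor b" and ?C = "half_factor c * half_factor d"
  define \<alpha>' where "\<alpha>' = 6 * \<alpha> - 1"
  have \<alpha>': "\<alpha>' = 3 * e1 ^ 2 - 8 * e2 - 1" by (simp add: \<alpha>'_def \<alpha>)
  have \<xi>': "8 * \<xi> = 1 / 2 * (1 - 2 * e1 ^ 2 + e1 ^ 4 - 256 * e4)" by (simp add: \<xi>)
  have eval: "poly (sk_symbol (e1 - 2) GPlus) (2 * z + 1) =
    poly (smult 128 (?A * ?C) + smult (8 * \<alpha>') (?A + ?C) + smult (16 * \<beta>) [:- 1 / 2, 1 / 2:]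
      + smult (8 * \<xi> - 8 * \<alpha>' * (a * b + c * d)) 1) (2 * z + 1)" for z
  proof -
    have half: "poly (half_factor u) (2 * z + 1) = u + z" for u
      by (simp add: half_factor_def field_simps)
    have lhs: "poly (sk_symbol (e1 - 2) GPlus) (2 * z + 1) = 1 / 2 * ((e1 + 4 * z)\<^sup>2 - 1)\<^sup>2"
      by (simp add: algebra_simps)
    have "((e1 + 4 * z)\<^sup>2 - 1)\<^sup>2 =
        256 * ((a + z) * (b + z) * ((c + z) * (d + z)))
        + 16 * \<alpha>' * ((a + z) * (b + z) + (c + z) * (d + z)) + 32 * \<beta> * z
        + (1 - 2 * e1 ^ 2 + e1 ^ 4 - 256 * e4) - 16 * \<alpha>' * (a * b + c * d)"
      unfolding \<alpha>' \<beta> e1 e2 e3 e4 by algebra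
    note expansion = this
    show ?thesis
      unfolding lhs expansion \<xi>' poly_add poly_smult poly_mult half by (simp add: field_simps)
  qed
  have "poly (sk_symbol (e1 - 2) GPlus) x =
    poly (smult 128 (?A * ?C) + smult (8 * \<alpha>') (?A + ?C) + smult (16 * \<beta>) [:- 1 / 2, 1 / 2:]
      + smult (8 * \<xi> - 8 * \<alpha>' * (a * b + c * d)) 1) x" for x
  proof -
    have "2 * ((x - 1) / 2) + 1 = x" by (simp add: field_simps)
    from eval[of "(x - 1) / 2", unfolded this] show ?thesis .
  qed
  then have "sk_symbol (e1 - 2) GPlus = smult 128 (?A * ?C) + smult (8 * \<alpha>') (?A + ?C)
      + smult (16 * \<beta>) [:- 1 / 2, 1 / 2:] + smult (8 * \<xi> - 8 * \<alpha>' * (a * b + c * d)) 1"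
    by (intro poly_eq_poly_eq_iff[THEN iffD1] ext)
  \<comment> \<open>The linear term is traded for the difference of the two products, whence \<beta>
    \<sigma> enters with opposite signs for the two pairs.\<close>
  also have "[:- 1 / 2, 1 / 2:] = smult \<sigma> (?A - ?C) - smult (\<sigma> * (a * b - c * d)) 1"
    using sigma_half_factor_diff by simp
  also have "smult 128 (?A * ?C) + smult (8 * \<alpha>') (?A + ?C)
      + smult (16 * \<beta>) (smult \<sigma> (?A - ?C) - smult (\<sigma> * (a * b - c * d)) 1)
      + smult (8 * \<xi> - 8 * \<alpha>' * (a * b + c * d)) 1 = ?R"
    unfolding \<alpha>'_def
    by (simp add: poly_eq_poly_eq_iff[symmetric] fun_eq_iff
        del: mult_pCons_left mult_pCons_right) (simp add: algebra_simps)
  finally show ?thesis .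
qed

section \<open>Action of the generators on the Wilson polynomials\<close>

lemma sk_op_0_wilson:
  "sk_op (e1 - 2) G0 (wilson_scaled a b c d n) =
     smult (4 * \<sigma> * (of_nat n + c + d - 1))
       (wilson_scaled (a + 1 / 2) (b + 1 / 2) (c - 1 / 2) (d - 1 / 2) n)
     + smult ((4 * \<sigma> * (a * b - c * d) - e1) * of_nat n * (of_nat n + e1 - 1))
       (wilson_scaled (a + 1 / 2) (b + 1 / 2) (c + 1 / 2) (d + 1 / 2) (n - 1))
     - smult (4 * \<sigma> * (of_nat n + a + b - 1))
       (wilson_scaled (a - 1 / 2) (b - 1 / 2) (c + 1 / 2) (d + 1 / 2) n)"
  unfolding sk_op_def sk_symbol_0 shift_op_diff_left shift_op_add_left shift_op_smult_left
    wilson_mixed wilson_diagonal wilson_lowering smult_smult e1[symmetric]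
  by (simp only: mult.assoc)

lemma sk_op_3_wilson:
  "sk_op (e1 - 2) G3 (wilson_scaled a b c d n) =
     - smult (4 * (of_nat n + a + b - 1))
       (wilson_scaled (a - 1 / 2) (b - 1 / 2) (c + 1 / 2) (d + 1 / 2) n)
     + smult (1 / 2 * (8 * (a * b + c * d) - e1 ^ 2 - 1) * of_nat n * (of_nat n + e1 - 1))
       (wilson_scaled (a + 1 / 2) (b + 1 / 2) (c + 1 / 2) (d + 1 / 2) (n - 1))
     - smult (4 * (of_nat n + c + d - 1))
       (wilson_scaled (a + 1 / 2) (b + 1 / 2) (c - 1 / 2) (d - 1 / 2) n)"
  unfolding sk_op_def sk_symbol_3 shift_op_diff_left shift_op_add_left shift_op_uminus_left
    shift_op_smult_left wilson_mixed wilson_diagonal wilson_lowering smult_smult e1[symmetric]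
  by (simp only: mult.assoc)

lemma sk_op_minus_wilson:
  "sk_op (e1 - 2) GMinus (wilson_scaled a b c d n) =
     - smult (1 / 2 * of_nat n * (of_nat n + e1 - 1))
       (wilson_scaled (a + 1 / 2) (b + 1 / 2) (c + 1 / 2) (d + 1 / 2) (n - 1))"
proof -
  have "sk_symbol (e1 - 2) GMinus = - smult (1 / 2) 1" by (simp add: one_pCons)
  then show ?thesis
    unfolding sk_op_def shift_op_uminus_left shift_op_smult_left wilson_lowering smult_smult
      e1[symmetric]
    by (simp only: shift_op_uminus_left shift_op_smult_left wilson_lowering smult_smult
        e1[symmetric] mult.assoc)
qed

lemma sk_op_plus_wilson:
  fixes e2 e3 e4 \<alpha> \<beta> \<xi> :: complex
  assumes "e2 = a * b + a * c + a * d + b * c + b * d + c * d"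
    and "e3 = a * b * c + a * b * d + a * c * d + b * c * d"
    and "e4 = a * b * c * d"
    and "\<alpha> = 1 / 2 * e1 ^ 2 - 4 / 3 * e2"
    and "\<beta> = - (e1 ^ 3) + 4 * e2 * e1 - 8 * e3"
    and "\<xi> = 1 / 16 * (1 - 2 * e1 ^ 2 + e1 ^ 4 - 256 * e4)"
  shows "sk_op (e1 - 2) GPlus (wilson_scaled a b c d n) =
     smult 128 (wilson_scaled (a - 1 / 2) (b - 1 / 2) (c - 1 / 2) (d - 1 / 2) (n + 1))
     + smult (8 * (6 * \<alpha> - 1 + 2 * \<beta> * \<sigma>) * (of_nat n + a + b - 1))
       (wilson_scaled (a - 1 / 2) (b - 1 / 2) (c + 1 / 2) (d + 1 / 2) n)
     + smult (8 * (6 * \<alpha> - 1 - 2 * \<beta> * \<sigma>) * (of_nat n + c + d - 1))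
       (wilson_scaled (a + 1 / 2) (b + 1 / 2) (c - 1 / 2) (d - 1 / 2) n)
     + smult (8 * ((1 - 6 * \<alpha>) * (a * b + c * d) - 2 * \<beta> * \<sigma> * (a * b - c * d) + \<xi>)
         * of_nat n * (of_nat n + e1 - 1))
       (wilson_scaled (a + 1 / 2) (b + 1 / 2) (c + 1 / 2) (d + 1 / 2) (n - 1))"
  unfolding sk_op_def sk_symbol_plus[OF assms] shift_op_add_left shift_op_smult_left
    wilson_raising wilson_mixed wilson_diagonal wilson_lowering smult_smult e1[symmetric]
  by (simp only: mult.assoc Suc_eq_plus1)

end

(* The factor 1 / 16 in \<xi> corrects the published 1 / 2, for which the operators do not satisfy
   [S3, S+] = {S0, S+}: with a = b = c = 1, d = 2, the constant terms of the two sides applied to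
   the polynomial x^2 would be -13312 and -27648. *)

theorem proposition8:
  fixes a b c d e1 e2 e3 e4 \<sigma> \<alpha> \<beta> \<xi> :: real
    and W Wmp Wpm Wpp Wmm :: "nat \<Rightarrow> complex poly"
  assumes "a > 0" "b > 0" "c > 0" "d > 0" "a + b \<noteq> c + d"
    and "\<sigma> = 1 / (a + b - c - d)"
    and "e1 = a + b + c + d"
    and "e2 = a * b + a * c + a * d + b * c + b * d + c * d"
    and "e3 = a * b * c + a * b * d + a * c * d + b * c * d"
    and "e4 = a * b * c * d"
    and "\<alpha> = 1 / 2 * e1 ^ 2 - 4 / 3 * e2"
    and "\<beta> = - (e1 ^ 3) + 4 * e2 * e1 - 8 * e3"
    and "\<xi> = 1 / 16 * (1 - 2 * e1 ^ 2 + e1 ^ 4 - 256 * e4)"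
    and "W = wilson_scaled a b c d"
    and "Wmp = wilson_scaled (a - 1 / 2) (b - 1 / 2) (c + 1 / 2) (d + 1 / 2)"
    and "Wpm = wilson_scaled (a + 1 / 2) (b + 1 / 2) (c - 1 / 2) (d - 1 / 2)"
    and "Wpp = wilson_scaled (a + 1 / 2) (b + 1 / 2) (c + 1 / 2) (d + 1 / 2)"
    and "Wmm = wilson_scaled (a - 1 / 2) (b - 1 / 2) (c - 1 / 2) (d - 1 / 2)"
  shows "\<exists>!\<rho>. sk_representation smult \<rho> \<and>
    (\<forall>n. \<rho> S0 (W n) =
       smult (4 * \<sigma> * (n + c + d - 1)) (Wpm n)
       + smult ((4 * \<sigma> * (a * b - c * d) - e1) * n * (n + e1 - 1)) (Wpp (n - 1))
       - smult (4 * \<sigma> * (n + a + b - 1)) (Wmp n)) \<and>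
    (\<forall>n. \<rho> S3 (W n) =
       - smult (4 * (n + a + b - 1)) (Wmp n)
       + smult (1 / 2 * (8 * (a * b + c * d) - e1 ^ 2 - 1) * n * (n + e1 - 1)) (Wpp (n - 1))
       - smult (4 * (n + c + d - 1)) (Wpm n)) \<and>
    (\<forall>n. \<rho> S_minus (W n) =
       - smult (1 / 2 * n * (n + e1 - 1)) (Wpp (n - 1))) \<and>
    (\<forall>n. \<rho> S_plus (W n) =
       smult 128 (Wmm (n + 1))
       + smult (8 * (6 * \<alpha> - 1 + 2 * \<beta> * \<sigma>) * (n + a + b - 1)) (Wmp n)
       + smult (8 * (6 * \<alpha> - 1 - 2 * \<beta> * \<sigma>) * (n + c + d - 1)) (Wpm n)
       + smult (8 * ((1 - 6 * \<alpha>) * (a * b + c * d) - 2 * \<beta> * \<sigma> * (a * b - c * d) + \<xi>)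
           * n * (n + e1 - 1)) (Wpp (n - 1)))"

proof -
  let ?a = "complex_of_real a" and ?b = "complex_of_real b" and ?c = "complex_of_real c"
    and ?d = "complex_of_real d" and ?e1 = "complex_of_real e1" and ?\<sigma> = "complex_of_real \<sigma>"
  have e1: "?e1 = ?a + ?b + ?c + ?d" using assms by simp
  have "\<sigma> * (a + b - c - d) = 1" using assms by simp
  then have \<sigma>: "?\<sigma> * (?a + ?b - ?c - ?d) = 1"
    by (metis of_real_1 of_real_add of_real_diff of_real_mult)
  interpret sk: sk_generator_action smult "sk_op (?e1 - 2)"
    by (rule sk_generator_action_sk_op)
  have e: "complex_of_real e2 = ?a * ?b + ?a * ?c + ?a * ?d + ?b * ?c + ?b * ?d + ?c * ?d"
    "complex_of_real e3 = ?a * ?b * ?c + ?a * ?b * ?d + ?a * ?c * ?d + ?b * ?c * ?d"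
    "complex_of_real e4 = ?a * ?b * ?c * ?d"
    using assms by simp_all
  have \<alpha>: "complex_of_real \<alpha> = 1 / 2 * ?e1 ^ 2 - 4 / 3 * complex_of_real e2"
    unfolding \<open>\<alpha> = _\<close> by simp
  have \<beta>: "complex_of_real \<beta> = - (?e1 ^ 3) + 4 * complex_of_real e2 * ?e1 - 8 * complex_of_real e3"
    unfolding \<open>\<beta> = _\<close> by simp
  have \<xi>: "complex_of_real \<xi> = 1 / 16 * (1 - 2 * ?e1 ^ 2 + ?e1 ^ 4 - 256 * complex_of_real e4)"
    unfolding \<open>\<xi> = _\<close> by simp
  have W: "coeff (W n) n \<noteq> 0" "n < k \<Longrightarrow> coeff (W n) k = 0" for n k
  proof -
    \<comment> \<open>For n = 0 the symbol is 1; for n \<ge> 1 its base n + e1 - 1 is positive,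
      hence so is every factor.\<close>
    have "pochhammer (real n + a + b + c + d - 1) n \<noteq> 0"
    proof (cases n)
      case (Suc m)
      then have "0 < real n + a + b + c + d - 1" using assms(1-4) by simp
      then show ?thesis using pochhammer_pos by (metis less_irrefl)
    qed simp
    moreover have "pochhammer (of_nat n + ?a + ?b + ?c + ?d - 1) n =
        complex_of_real (pochhammer (real n + a + b + c + d - 1) n)"
      by (simp flip: pochhammer_of_real)
    ultimately show "coeff (W n) n \<noteq> 0"
      using assms coeff_wilson_scaled(2)[of a b c d n] by simp
    show "coeff (W n) k = 0" if "n < k"
      using assms coeff_wilson_scaled(1)[of n k a b c d] that by simp
  qed
  show ?thesis
  proof (rule ex_ex1I, goal_cases)
    case 1
    show ?case
      unfolding \<open>W = _\<close> \<open>Wmp = _\<close> \<open>Wpm = _\<close> \<open>Wpp = _\<close> \<open>Wmm = _\<close>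
    \<comment> \<open>The witness is the action generated by the difference operators; h = e1 - 2
      makes their symbols the combinations computed above.\<close>
    proof (intro exI[of _ sk.action] conjI allI sk.sk_representation_action, unfold sk.action_gen,
        goal_cases)
      case (1 n)
      show ?case unfolding sk_op_0_wilson[OF e1 \<sigma>] by simp
    next
      case (2 n)
      show ?case unfolding sk_op_3_wilson[OF e1 \<sigma>] by simp
    next
      case (3 n)
      show ?case unfolding sk_op_minus_wilson[OF e1 \<sigma>] by simp
    next
      case (4 n)
      show ?case unfolding sk_op_plus_wilson[OF e1 \<sigma> e \<alpha> \<beta> \<xi>] by simp
    qed
  next
    case (2 \<rho> \<rho>')
    have rep: "sk_representation smult \<rho>" "sk_representation smult \<rho>'" using 2 by blast+
    then have lin: "Vector_Spaces.linear smult smult (\<rho> u)"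
        "Vector_Spaces.linear smult smult (\<rho>' u)" for u
      by (simp_all add: sk_representation_def)
    \<comment> \<open>Prescribed values on the triangular family \<open>W n\<close> fix each
      generator as an operator.\<close>
    have eq: "\<rho> u = \<rho>' u" if "\<And>n. \<rho> u (W n) = \<rho>' u (W n)" for u
      using linear_eq_on_triangular_family[OF lin W that] .
    show ?case
      by (rule sk_representation_eqI[OF rep]; rule eq) (use 2 in simp_all)
  qed
qed

end
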